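(* Let $n\geq 5$ be an integer. Then $\mathcal{D}_3(\vec{C}_{2n+1}\langle n\rangle)$ is connected and has diameter at most $3n+4+\lfloor\frac{2n+1}{3}\rfloor$.
   Context: For $n\ge2$, $\vec{C}_{2n+1}\langle n\rangle$ is the tournament with vertex set $\mathbb{Z}_{2n+1}$ and arcs $(a,a+j)$ for all $a\in\mathbb{Z}_{2n+1}$, $j\in\{1,\dots,n-1\}$, together with arcs $(a,a-n)$ for all $a\in\mathbb{Z}_{2n+1}$. A $k$-coloring of a digraph $D$ is a function $\alpha\colon V(D)\to\{1,\dots,k\}$ such that every color class $\{x:\alpha(x)=i\}$ (possibly empty) induces an acyclic subdigraph. The $k$-dicoloring graph $\mathcal{D}_k(D)$ has the $k$-colorings of $D$ as vertices, two being adjacent iff they differ on exactly one vertex. *)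

theory Defs
  imports "Graph_Theory.Graph_Theory" "HOL-Library.FuncSet"
begin

text \<open>The integers modulo \<open>2 * n + 1\<close> are represented by the residues
  \<open>0, ..., 2 * n\<close>. For \<open>n \<ge> 2\<close> the digraph below is a tournament.\<close>

definition circulant_tournament :: "nat \<Rightarrow> int pair_pre_digraph" where
  "circulant_tournament n =
     (let m = 2 * int n + 1 in
      \<lparr> pverts = {0..<m},
        parcs = {(a, (a + j) mod m) | a j. a \<in> {0..<m} \<and> j \<in> {1..int n - 1}}
              \<union> {(a, (a - int n) mod m) | a. a \<in> {0..<m}} \<rparr>)"

text \<open>Library cycles are directed and nonempty; loops and 2-cycles are included.\<close>

definition acyclic_digraph :: "('a, 'b) pre_digraph \<Rightarrow> bool" where
  "acyclic_digraph G \<longleftrightarrow> \<not> (\<exists>p. pre_digraph.cycle G p)"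

text \<open>Colorings are extensional, so that two colorings are equal as soon as
  they agree on the vertices of \<open>D\<close>.\<close>

definition dicolorings :: "nat \<Rightarrow> ('a, 'b) pre_digraph \<Rightarrow> ('a \<Rightarrow> nat) set" where
  "dicolorings k D =
     {\<alpha> \<in> verts D \<rightarrow>\<^sub>E {1..k}.
        \<forall>i\<in>{1..k}. acyclic_digraph (D \<restriction> {x \<in> verts D. \<alpha> x = i})}"

text \<open>An undirected edge is encoded by the two opposite arcs.\<close>

definition dicoloring_graph ::
    "nat \<Rightarrow> ('a, 'b) pre_digraph \<Rightarrow> ('a \<Rightarrow> nat) pair_pre_digraph" where
  "dicoloring_graph k D =
     \<lparr> pverts = dicolorings k D,
       parcs = {(\<alpha>, \<beta>). \<alpha> \<in> dicolorings k D \<and> \<beta> \<in> dicolorings k D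
                        \<and> (\<exists>!x. x \<in> verts D \<and> \<alpha> x \<noteq> \<beta> x)} \<rparr>"

text \<open>With unit arc weights, \<open>\<mu>\<close> is the length of a shortest walk, and
  \<open>\<infinity>\<close> if there is none.\<close>

definition graph_diameter :: "('a, 'b) pre_digraph \<Rightarrow> ereal" where
  "graph_diameter G =
     (SUP u\<in>verts G. SUP v\<in>verts G. wf_digraph.\<mu> G (\<lambda>_. 1) u v)"

lemma wf_digraph_dicoloring_graph: "wf_digraph (dicoloring_graph k D)"
  by unfold_locales (auto simp: dicoloring_graph_def)

lemma symmetric_dicoloring_graph: "symmetric (dicoloring_graph k D)"
  unfolding symmetric_def by (auto simp: dicoloring_graph_def sym_def eq_commute)

end

theory Submission
  imports Defs
begin

text \<open>Write \<open>m = 2 * r + 1\<close> with \<open>r = n\<close>. An acyclic class has a source, so it lies in \<open>r\<close>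
  consecutive vertices, or it has the form \<open>{p} \<union> S \<union> {p + r + 1}\<close> with \<open>S\<close>
  strictly between \<open>p + 1\<close> and \<open>p + r\<close>, or it is \<open>{p, p + r, p + r + 1}\<close>. If all three classes
  lie in windows of \<open>r\<close> vertices, then the windows have a cyclic order, and each of the three
  boundaries between consecutive classes is blurred inside the overlap of two windows.

  A hub is a partition into intervals of lengths \<open>1, r, r\<close>. In two steps its singleton can
  jump to the opposite side, which reverses the cyclic order of the classes. A colouring is
  contracted to a hub by emptying its smallest class, which has at most \<open>m div 3\<close> vertices,
  and then the hub is rotated towards the target. Rotating upwards and rotating downwards cost
  about \<open>3 * m\<close> together, so one of the two directions costs at most about \<open>3 * r\<close>.

  A blurred boundary of the source can be sharpened at either end, and one picks the end that
  lies in the direction of the rotation. In the same way, a class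
  \<open>{p} \<union> S \<union> {p + r + 1}\<close> of the target is reached through a repair of the end
  from which the rotation arrives, so that the repair costs nothing extra. The few colourings
  that do not fit this pattern are one step from colourings from which both cyclic orders are
  within reach.\<close>

section \<open>Distances in digraphs\<close>

text \<open>The constants come from one balance. Away from the overlaps a rotation moves all three
  boundaries, so a hub at position \<open>t\<close> reaches the target in
  \<open>\<kappa> - 3 * t\<close> steps from below and in \<open>3 * t - \<kappa>\<close> steps from
  above, with the same \<kappa>. Over a full turn this adds up to \<open>3 * m = 6 * r + 3\<close>,
  hence the cheaper direction costs at most \<open>3 * r + 1\<close>. Contracting a smallest class
  with \<open>l\<close> vertices leads to two hubs at distance \<open>u + v\<close>, for
  \<open>l - 1 + u\<close> and \<open>l - 1 + v\<close> steps, and that distance pays for the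
  surcharges \<open>u\<close> and \<open>v\<close>. This gives \<open>3 * r + l\<close> for equal
  cyclic orders. Reversing takes two steps, but the choice between the two opposite positions wins
  one back. Up to three repairs of gapped classes in the source complete the constant 4. Nothing is
  left for repairs in the target, which is why they must be absorbed by the rotation. An exceptional
  colouring spends two steps at its end and then chooses the cyclic order, so it never pays for a
  reversal.\<close>

definition within_dist ::
  "('a, 'b) pre_digraph \<Rightarrow> 'a \<Rightarrow> 'a \<Rightarrow> int \<Rightarrow> bool" where
  "within_dist G u v k \<longleftrightarrow> u \<in> verts G \<and> v \<in> verts G
    \<and> (\<exists>j. int j \<le> k \<and> (u, v) \<in> arcs_ends G ^^ j)"

lemma within_dist_refl: "u \<in> verts G \<Longrightarrow> 0 \<le> k \<Longrightarrow> within_dist G u u k"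
  unfolding within_dist_def by (intro conjI exI[of _ 0]) auto

lemma within_dist_mono:
  "within_dist G u v k \<Longrightarrow> k \<le> l \<Longrightarrow> within_dist G u v l"
  unfolding within_dist_def by (meson order_trans)

lemma within_dist_trans:
  "within_dist G u v k \<Longrightarrow> within_dist G v w l \<Longrightarrow> within_dist G u w (k + l)"
  unfolding within_dist_def
proof (elim conjE exE, intro conjI)
  fix i j
  assume "int i \<le> k" "int j \<le> l" and ij: "(u, v) \<in> arcs_ends G ^^ i"
    "(v, w) \<in> arcs_ends G ^^ j"
  moreover have "(u, w) \<in> arcs_ends G ^^ (i + j)"
    using ij by (auto simp: relpow_add)
  ultimately show "\<exists>h. int h \<le> k + l \<and> (u, w) \<in> arcs_ends G ^^ h"
    by (intro exI[of _ "i + j"]) auto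
qed

lemma within_dist_sym:
  assumes "symmetric G" "within_dist G u v k"
  shows "within_dist G v u k"
proof -
  have "sym (arcs_ends G ^^ j)" for j
  proof (induction j)
    case (Suc j)
    have "(arcs_ends G)\<inverse> = arcs_ends G"
      using assms(1) by (simp add: symmetric_def sym_conv_converse_eq)
    moreover have "(arcs_ends G ^^ j)\<inverse> = arcs_ends G ^^ j"
      using Suc.IH by (simp add: sym_conv_converse_eq)
    ultimately have "(arcs_ends G ^^ Suc j)\<inverse> = arcs_ends G O arcs_ends G ^^ j"
      by (simp add: converse_relcomp)
    also have "\<dots> = arcs_ends G ^^ Suc j"
      by (simp add: relpow_commute)
    finally show ?case by (simp add: sym_conv_converse_eq)
  qed (simp add: sym_Id)
  then show ?thesis
    using assms(2) unfolding within_dist_def by (meson symD)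
qed

lemma (in wf_digraph) within_dist_awalk:
  assumes "within_dist G u v k"
  shows "\<exists>p. awalk u p v \<and> int (length p) \<le> k"
proof -
  obtain j where j: "int j \<le> k" "(u, v) \<in> arcs_ends G ^^ j" and v: "v \<in> verts G"
    using assms unfolding within_dist_def by blast
  have "\<exists>p. awalk u p v \<and> length p = j"
    using j(2)
  proof (induction j arbitrary: u)
    case 0
    then show ?case using v by (auto simp: awalk_Nil_iff)
  next
    case (Suc j)
    then obtain w where w: "(u, w) \<in> arcs_ends G" "(w, v) \<in> arcs_ends G ^^ j"
      by (meson relpow_Suc_E2)
    obtain p where p: "awalk w p v" "length p = j" using Suc.IH[OF w(2)] by blast
    obtain e where e: "e \<in> arcs G" "tail G e = u" "head G e = w" using w(1) by auto
    then have "awalk u (e # p) v" using p by (auto simp: awalk_Cons_iff)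
    then show ?case using p(2) by (intro exI[of _ "e # p"]) auto
  qed
  then show ?thesis using j by auto
qed

lemma diameter_bound:
  assumes "wf_digraph G" "verts G \<noteq> {}"
    and all: "\<And>u v. u \<in> verts G \<Longrightarrow> v \<in> verts G
      \<Longrightarrow> within_dist G u v (int k)"
  shows "Digraph_Component.connected G \<and> graph_diameter G \<le> ereal (real k)"
proof
  interpret wf_digraph G by fact
  have "(u, v) \<in> rtrancl_on (verts G) ((arcs_ends G)\<^sup>s)"
    if uv: "u \<in> verts G" "v \<in> verts G" for u v
  proof -
    have "u \<rightarrow>\<^sup>*\<^bsub>G\<^esub> v"
      using within_dist_awalk[OF all[OF uv]] reachable_awalk by blast
    then show ?thesis
      unfolding reachable_def by (rule rtrancl_on_mono[rotated 2]) (auto simp: symcl_def)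
  qed
  then show "Digraph_Component.connected G"
    unfolding connected_conv using assms(2) by blast
  have "\<mu> (\<lambda>_. 1) u v \<le> ereal (real k)" if uv: "u \<in> verts G" "v \<in> verts G" for u v
  proof -
    obtain p where p: "awalk u p v" "length p \<le> k"
      using within_dist_awalk[OF all[OF uv]] by auto
    have "awalk_cost (\<lambda>_. 1) p = real (length p)"
      unfolding awalk_cost_def by (induction p) auto
    then have "\<mu> (\<lambda>_. 1) u v \<le> ereal (real (length p))"
      using min_cost_le_walk_cost[OF p(1)] by metis
    also have "\<dots> \<le> ereal (real k)" using p(2) by simp
    finally show ?thesis .
  qed
  then show "graph_diameter G \<le> ereal (real k)"
    unfolding graph_diameter_def by (intro SUP_least) auto
qed

text \<open>Every nonempty closed walk contains a library cycle. Working with the arc relation makes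
  rank functions and well-foundedness available.\<close>

lemma acyclic_digraph_iff:
  assumes "wf_digraph G"
  shows "acyclic_digraph G \<longleftrightarrow> acyclic (arcs_ends G)"
proof -
  interpret wf_digraph G by fact
  have "(\<exists>p. cycle p) \<longleftrightarrow> (\<exists>u p. awalk u p u \<and> p \<noteq> [])"
    using closed_w_imp_cycle unfolding closed_w_def cycle_def by (metis length_greater_0_conv)
  then show ?thesis
    unfolding acyclic_digraph_def acyclic_def by (auto simp: reachable1_awalk)
qed

lemma residue_window:
  fixes z s m :: int
  assumes "0 < m"
  obtains y where "s \<le> y" "y < s + m" "y mod m = z mod m"
proof
  show "s \<le> s + (z - s) mod m" "s + (z - s) mod m < s + m" using assms by auto
  show "(s + (z - s) mod m) mod m = z mod m" by (simp add: mod_add_right_eq)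
qed

section \<open>The tournament in terms of residues modulo \<open>m\<close>\<close>

locale circulant =
  fixes n :: nat and r m :: int
  assumes n5: "5 \<le> n" and r: "r = int n" and m: "m = 2 * r + 1"
begin

definition V :: "int set" where "V = {0..<m}"

abbreviation colorings :: "(int \<Rightarrow> nat) set" where
  "colorings \<equiv> dicolorings 3 (circulant_tournament n)"

abbreviation close ::
  "(int \<Rightarrow> nat) \<Rightarrow> (int \<Rightarrow> nat) \<Rightarrow> int \<Rightarrow> bool" where
  "close \<equiv> within_dist (dicoloring_graph 3 (circulant_tournament n))"

text \<open>The residues \<open>(y - x) mod m\<close> that carry an arc from \<open>x\<close> to
  \<open>y\<close>; the backward arc \<open>- r\<close> appears as \<open>r + 1\<close>. The residue
  \<open>r\<close> is missing, and this is the source of all holes in the windows below.\<close>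

definition conn :: "int \<Rightarrow> bool" where
  "conn j \<longleftrightarrow> 1 \<le> j \<and> j \<le> r - 1 \<or> j = r + 1"

definition mono_arcs :: "int set \<Rightarrow> (int \<times> int) set" where
  "mono_arcs X = {(x, y). x \<in> X \<and> y \<in> X \<and> conn ((y - x) mod m)}"

text \<open>Periodic extension to all integers, so that cyclic windows become integer intervals and
  cyclic order becomes \<open><\<close>.\<close>

definition col :: "(int \<Rightarrow> nat) \<Rightarrow> int \<Rightarrow> nat" where
  "col \<alpha> z = \<alpha> (z mod m)"

lemma r5: "5 \<le> r" and m_pos: "0 < m" using n5 r m by auto

lemma finite_V: "finite V" unfolding V_def by simp

lemma mod_in_V: "z mod m \<in> V" unfolding V_def using m_pos by simp

lemma V_eq: "V = {0..<2 * int n + 1}"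
  unfolding V_def using m r by simp

lemma verts_circulant: "verts (circulant_tournament n) = V"
  unfolding V_eq by (simp add: circulant_tournament_def Let_def)

lemma arcs_circulant:
  "arcs (circulant_tournament n) = {(x, y). x \<in> V \<and> y \<in> V \<and> conn ((y - x) mod m)}" (is
    "?L = ?R")
proof -
  have L: "?L = {(a, (a + j) mod m) | a j. a \<in> V
    \<and> j \<in> {1..r - 1}} \<union> {(a, (a - r) mod m) | a. a \<in> V}"
    unfolding V_eq by (simp add: circulant_tournament_def Let_def m r)
  show ?thesis
  proof (intro set_eqI iffI)
    fix e assume "e \<in> ?L"
    then consider a j where "e = (a, (a + j) mod m)" "a \<in> V" "1 \<le> j" "j \<le> r - 1"
      | a where "e = (a, (a - r) mod m)" "a \<in> V"
      unfolding L by auto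
    then show "e \<in> ?R"
    proof cases
      case 1
      have "((a + j) mod m - a) mod m = j" using 1 m r5 by (simp add: mod_diff_left_eq)
      then show ?thesis using 1 mod_in_V by (auto simp: conn_def)
    next
      case 2
      have "((a - r) mod m - a) mod m = (- r) mod m" by (simp add: mod_diff_left_eq)
      also have "\<dots> = (r + 1) mod m"
        using mod_add_self2[of "-r" m] m by (simp add: algebra_simps)
      also have "\<dots> = r + 1" using m r5 by simp
      finally show ?thesis using 2 mod_in_V by (auto simp: conn_def)
    qed
  next
    fix e assume "e \<in> ?R"
    then obtain x y where e: "e = (x, y)" "x \<in> V" "y \<in> V" and c: "conn ((y - x) mod m)" by auto
    define j where "j = (y - x) mod m"
    have y: "y = (x + j) mod m" unfolding j_def using e by (simp add: mod_add_right_eq V_def)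
    show "e \<in> ?L"
    proof (cases "j = r + 1")
      case True
      then have "y = (x - r) mod m"
        using y mod_add_self2[of "x - r" m] m by (simp add: algebra_simps)
      then show ?thesis unfolding L using e by auto
    next
      case False
      then have "1 \<le> j" "j \<le> r - 1" using c unfolding j_def[symmetric] conn_def by auto
      then have "(x, (x + j) mod m) \<in> ?L" unfolding L using e(2) by auto
      then show ?thesis using e(1) y by simp
    qed
  qed
qed

lemma acyclic_induced_iff:
  assumes "X \<subseteq> V"
  shows "acyclic_digraph (circulant_tournament n \<restriction> X) \<longleftrightarrow> acyclic
    (mono_arcs X)"
proof -
  have "wf_digraph (circulant_tournament n \<restriction> X)"
    by unfold_locales auto
  moreover have "arcs_ends (circulant_tournament n \<restriction> X) = mono_arcs X"
    using assms unfolding arcs_ends_def arc_to_ends_def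
    by (auto simp: arcs_circulant mono_arcs_def image_iff simp del: with_proj_simps(2))
  ultimately show ?thesis by (simp add: acyclic_digraph_iff)
qed

lemma colorings_iff:
  "\<alpha> \<in> colorings \<longleftrightarrow>
    \<alpha> \<in> V \<rightarrow>\<^sub>E {1..3} \<and> (\<forall>i\<in>{1..3}. acyclic (mono_arcs {x
      \<in> V. \<alpha> x = i}))"
  unfolding dicolorings_def verts_circulant by (auto simp: acyclic_induced_iff)

lemma close_refl: "\<alpha> \<in> colorings \<Longrightarrow> 0 \<le> k
  \<Longrightarrow> close \<alpha> \<alpha> k"
  by (rule within_dist_refl) (auto simp: dicoloring_graph_def)

lemma close_sym: "close \<alpha> \<beta> k \<Longrightarrow> close \<beta> \<alpha> k"
  by (rule within_dist_sym[OF symmetric_dicoloring_graph])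

lemma close_one:
  assumes "\<alpha> \<in> colorings" "\<beta> \<in> colorings"
    "\<And>z. z \<in> V \<Longrightarrow> z \<noteq> x \<Longrightarrow> \<alpha> z = \<beta> z"
  shows "close \<alpha> \<beta> 1"
proof (cases "\<exists>z\<in>V. \<alpha> z \<noteq> \<beta> z")
  case True
  then have "\<exists>!z. z \<in> V \<and> \<alpha> z \<noteq> \<beta> z" using assms(3) by blast
  then have "\<exists>!z. z \<in> verts (circulant_tournament n) \<and> \<alpha> z \<noteq> \<beta> z"
    unfolding verts_circulant .
  then have "(\<alpha>, \<beta>) \<in> arcs_ends (dicoloring_graph 3 (circulant_tournament n))"
    using assms(1,2)
    by (simp add: dicoloring_graph_def arcs_ends_def arc_to_ends_def image_iff)
  then show ?thesis
    using assms(1,2) unfolding within_dist_def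
    by (intro conjI exI[of _ 1]) (auto simp: dicoloring_graph_def)
next
  case False
  then have "\<alpha> = \<beta>"
    using assms(1,2) unfolding colorings_iff
    by (intro PiE_ext[of \<alpha> V "\<lambda>_. {1..3}"]) auto
  then show ?thesis using assms(1) close_refl by simp
qed

end

section \<open>Acyclic colour classes\<close>

lemma acyclic_if_rank:
  fixes f :: "'a \<Rightarrow> int"
  assumes "\<And>x y. (x, y) \<in> R \<Longrightarrow> f x < f y"
  shows "acyclic R"
proof -
  have "f x < f y" if "(x, y) \<in> R\<^sup>+" for x y
    using that by (induction rule: trancl_induct) (auto dest: assms intro: order.strict_trans)
  then show ?thesis unfolding acyclic_def by blast
qed

context circulant
begin

text \<open>With flag \<open>e = 0\<close> the class \<open>i\<close> lies in the window \<open>{p..<p + r}\<close> modulo \<open>m\<close>, with flag \<open>e = 1\<close>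
  in \<open>{p} \<union> {p + 2..<p + r} \<union> {p + r + 1}\<close>. Subsets of both are acyclic.\<close>

definition fits :: "(int \<Rightarrow> nat) \<Rightarrow> nat \<Rightarrow> int \<Rightarrow> int
  \<Rightarrow> bool" where
  "fits \<alpha> i p e \<longleftrightarrow> (\<forall>z. p \<le> z \<and> z < p + m
    \<and> col \<alpha> z = i \<longrightarrow>
     z < p + r + 2 * e \<and> (e = 1 \<longrightarrow> z \<noteq> p + 1 \<and> z \<noteq> p + r))"

lemma fitsD:
  assumes "fits \<alpha> i p e" "p \<le> z" "z < p + m" "col \<alpha> z = i"
  shows "z < p + r + 2 * e" "e = 1 \<Longrightarrow> z \<noteq> p + 1"
    "e = 1 \<Longrightarrow> z \<noteq> p + r"
  using assms unfolding fits_def by auto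

lemma col_cong: "z mod m = w mod m \<Longrightarrow> col \<alpha> z = col \<alpha> w"
  unfolding col_def by simp

lemma col_shift [simp]:
  "col \<alpha> (z + m) = col \<alpha> z" "col \<alpha> (z - m) = col \<alpha> z"
    "col \<alpha> (z + k * m) = col \<alpha> z"
  "col \<alpha> (z - k * m) = col \<alpha> z"
proof -
  show k: "col \<alpha> (z + k * m) = col \<alpha> z" for k by (rule col_cong) simp
  show "col \<alpha> (z + m) = col \<alpha> z" using k[of 1] by simp
  show "col \<alpha> (z - m) = col \<alpha> z" using k[of "-1"] by simp
  show "col \<alpha> (z - k * m) = col \<alpha> z" using k[of "-k"] by simp
qed

lemma mod_small: "0 \<le> d \<Longrightarrow> d < m \<Longrightarrow> d mod m = d"
  by simp

lemma mod_neg: "- m < d \<Longrightarrow> d < 0 \<Longrightarrow> d mod m = d + m"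
  using mod_add_self2[of d m] mod_small[of "d + m"] by simp

lemma mod_eq_window:
  assumes "p \<le> z" "z < p + m" "p \<le> w" "w < p + m"
  shows "z mod m = w mod m \<longleftrightarrow> z = w"
proof
  assume "z mod m = w mod m"
  then have "(z - p) mod m = (w - p) mod m" by (rule mod_diff_cong) simp
  then show "z = w" using assms mod_small[of "z - p"] mod_small[of "w - p"] by simp
qed simp

lemma fits_shift: "fits \<alpha> i (p + k * m) e \<longleftrightarrow> fits \<alpha> i p e"
proof -
  have imp: "fits \<alpha> i (p + k * m) e" if f: "fits \<alpha> i p e" for p k
    unfolding fits_def
  proof (intro allI impI, elim conjE)
    fix z assume z: "p + k * m \<le> z" "z < p + k * m + m" "col \<alpha> z = i"
    have "p \<le> z - k * m" "z - k * m < p + m" "col \<alpha> (z - k * m) = i" using z by auto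
    from fitsD[OF f this] show "z < p + k * m + r + 2 * e \<and>
        (e = 1 \<longrightarrow> z \<noteq> p + k * m + 1 \<and> z \<noteq> p + k * m + r)"
      by auto
  qed
  show ?thesis
    using imp[of p k] imp[of "p + k * m" "- k"] by auto
qed

text \<open>The offset from \<open>p\<close> increases along every arc inside the class. A
  descending arc would need an offset difference of \<open>r\<close> or at least
  \<open>r + 2\<close>. For flag 1 the offsets are at most \<open>r + 1\<close>, and the holes
  \<open>p + 1\<close> and \<open>p + r\<close> exclude the difference \<open>r\<close>.\<close>

lemma acyclic_fits:
  assumes "fits \<alpha> i p e" "e = 0 \<or> e = 1"
  shows "acyclic (mono_arcs {x \<in> V. \<alpha> x = i})"
proof (rule acyclic_if_rank[where f = "\<lambda>x. (x - p) mod m"])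
  fix x y assume "(x, y) \<in> mono_arcs {x \<in> V. \<alpha> x = i}"
  then have xy: "x \<in> V" "y \<in> V" "\<alpha> x = i" "\<alpha> y = i" and c: "conn ((y - x) mod m)"
    unfolding mono_arcs_def by auto
  define a b where "a = (x - p) mod m" and "b = (y - p) mod m"
  have ab: "0 \<le> a" "a < m" "0 \<le> b" "b < m" using m_pos by (auto simp: a_def b_def)
  have "(p + a) mod m = x mod m" "(p + b) mod m = y mod m"
    unfolding a_def b_def by (simp_all add: mod_add_right_eq)
  then have "col \<alpha> (p + a) = i" "col \<alpha> (p + b) = i"
    using xy unfolding col_def V_def by simp_all
  then have *: "a < r + 2 * e" "e = 1 \<longrightarrow> a \<noteq> 1 \<and> a \<noteq> r" "b < r + 2 * e"
    "e = 1 \<longrightarrow> b \<noteq> 1 \<and> b \<noteq> r"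
    using fitsD[OF assms(1), of "p + a"] fitsD[OF assms(1), of "p + b"] ab by auto
  have "(y - x) mod m = (b - a) mod m" unfolding a_def b_def by (simp add: mod_diff_eq)
  also have "\<dots> = (if a \<le> b then b - a else b - a + m)"
    using ab mod_small[of "b - a"] mod_neg[of "b - a"] by auto
  finally have "conn (if a \<le> b then b - a else b - a + m)" using c by simp
  then have "a < b" using * ab assms(2) m r5 unfolding conn_def
    by (auto split: if_splits)
  then show "(x - p) mod m < (y - p) mod m" unfolding a_def b_def .
qed

text \<open>\<open>conn\<close> holds neither for 0 nor for a residue together with its negative, so
  two vertices carry no cycle. Needed in \<open>hub_swap\<close>, where one class consists of two
  opposite vertices.\<close>

lemma acyclic_pair:
  assumes "\<And>z. z \<in> V \<Longrightarrow> \<alpha> z = i \<Longrightarrow> z = x \<or> z = y"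
    "x \<in> V" "y \<in> V"
  shows "acyclic (mono_arcs {x \<in> V. \<alpha> x = i})"
proof -
  have not_refl: "\<not> conn 0" using r5 unfolding conn_def by auto
  have anti: "\<not> conn ((b - a) mod m)" if "conn ((a - b) mod m)" for a b
  proof
    assume "conn ((b - a) mod m)"
    moreover have "(b - a) mod m = (if (a - b) mod m = 0 then 0 else m - (a - b) mod m)"
      using zmod_zminus1_eq_if[of "a - b" m] by simp
    ultimately show False using that not_refl m r5 unfolding conn_def by (auto split: if_splits)
  qed
  show ?thesis
  proof (cases "conn ((y - x) mod m)")
    case True
    show ?thesis
      by (rule acyclic_if_rank[where f = "\<lambda>z. if z = x then 0 else 1"])
        (use assms True anti not_refl in \<open>auto simp: mono_arcs_def\<close>)
  next
    case False
    show ?thesis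
      by (rule acyclic_if_rank[where f = "\<lambda>z. if z = y then 0 else 1"])
        (use assms False anti not_refl in \<open>auto simp: mono_arcs_def\<close>)
  qed
qed

lemma coloring_range:
  assumes "\<alpha> \<in> V \<rightarrow>\<^sub>E {1..3}"
  shows "col \<alpha> z \<in> {1..3}"
  using assms mod_in_V unfolding col_def by (auto simp: PiE_iff)

text \<open>A finite acyclic relation is well-founded, so the class has a vertex \<open>s\<close>
  without in-neighbours in the class. The offsets from which no arc leads to \<open>s\<close> are
  \<open>0..r - 1\<close> and \<open>r + 1\<close>.\<close>

lemma source:
  assumes "\<alpha> \<in> colorings" "col \<alpha> w = i"
  obtains s where "col \<alpha> s = i"
    "\<And>z. s \<le> z \<Longrightarrow> z < s + m \<Longrightarrow> col \<alpha> z = i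
      \<Longrightarrow> z < s + r \<or> z = s + r + 1"
proof -
  let ?X = "{x \<in> V. \<alpha> x = i}"
  have i: "i \<in> {1..3}" using assms coloring_range colorings_iff by blast
  then have "acyclic (mono_arcs ?X)" using assms(1) unfolding colorings_iff by blast
  moreover have "finite (mono_arcs ?X)"
    by (rule finite_subset[of _ "V \<times> V"]) (auto simp: mono_arcs_def finite_V)
  ultimately have "wf (mono_arcs ?X)" by (rule finite_acyclic_wf[rotated])
  moreover have "w mod m \<in> ?X" using assms(2) mod_in_V unfolding col_def by simp
  ultimately obtain s where s: "s \<in> ?X"
    "\<And>y. (y, s) \<in> mono_arcs ?X \<Longrightarrow> y \<notin> ?X"
    by (rule wfE_min) blast
  show ?thesis
  proof
    show "col \<alpha> s = i" using s(1) unfolding col_def V_def by simp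
    fix z assume z: "s \<le> z" "z < s + m" "col \<alpha> z = i"
    have "z mod m \<in> ?X" using z(3) mod_in_V unfolding col_def by simp
    then have nc: "\<not> conn ((s - z mod m) mod m)" using s unfolding mono_arcs_def by blast
    have "(s - z mod m) mod m = (s - z) mod m" by (simp add: mod_diff_right_eq)
    also have "\<dots> = (if z = s then 0 else m - (z - s))"
      using z mod_neg[of "s - z"] by auto
    finally show "z < s + r \<or> z = s + r + 1"
      using nc z m r5 unfolding conn_def by (auto split: if_splits)
  qed
qed

text \<open>The forcing tool of the classification: two vertices of a directed triangle that share a
  colour forbid it on the third. The last arc ends in \<open>x + m\<close>, so that a triangle
  winding once around is given by three integer differences with sum \<open>m\<close>.\<close>

lemma no_triangle:
  assumes "\<alpha> \<in> colorings" "col \<alpha> x = i" "col \<alpha> y = i" "col \<alpha> z = i"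
    and "conn (y - x)" "conn (z - y)" "conn (x + m - z)"
  shows False
proof -
  let ?X = "{x \<in> V. \<alpha> x = i}"
  have arc: "(a mod m, b mod m) \<in> mono_arcs ?X"
    if "col \<alpha> a = i" "col \<alpha> b = i" "conn (b - a)" for a b
  proof -
    have "(b mod m - a mod m) mod m = (b - a) mod m" by (rule mod_diff_eq)
    also have "\<dots> = b - a" using that(3) m r5 unfolding conn_def by auto
    finally show ?thesis using that mod_in_V unfolding mono_arcs_def col_def by simp
  qed
  have "(x mod m, y mod m) \<in> mono_arcs ?X" "(y mod m, z mod m) \<in> mono_arcs ?X"
    "(z mod m, (x + m) mod m) \<in> mono_arcs ?X"
    using arc[of x y] arc[of y z] arc[of z "x + m"] assms(2-7) by simp_all
  then have "(x mod m, x mod m) \<in> (mono_arcs ?X)\<^sup>+"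
    unfolding mod_add_self2 by (blast intro: trancl_into_trancl)
  moreover have "i \<in> {1..3}" using assms coloring_range colorings_iff by blast
  ultimately show False using assms(1) unfolding colorings_iff acyclic_def by blast
qed

text \<open>Split on whether the source \<open>s\<close> has \<open>s + r + 1\<close> and
  \<open>s + 1\<close> in its class. If both are there, any further \<open>z\<close> closes the
  triangle \<open>s + 1\<close>, \<open>z\<close>, \<open>s + r + 1\<close>, so the class has only
  three vertices.\<close>

lemma class_type:
  assumes \<alpha>: "\<alpha> \<in> colorings" and w: "col \<alpha> w = i"
  obtains (arc) p where "col \<alpha> p = i" "fits \<alpha> i p 0"
  | (gapped) p where "col \<alpha> p = i" "col \<alpha> (p + r + 1) = i" "fits \<alpha> i p 1"
  | (triple) p where "col \<alpha> p = i" "col \<alpha> (p + r) = i" "col \<alpha> (p + r + 1) = i"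
      "\<And>z. p \<le> z \<Longrightarrow> z < p + m \<Longrightarrow> col \<alpha> z = i
        \<Longrightarrow> z = p \<or> z = p + r \<or> z = p + r + 1"
proof -
  obtain s where s: "col \<alpha> s = i"
    and src: "\<And>z. s \<le> z \<Longrightarrow> z < s + m \<Longrightarrow> col \<alpha> z = i
      \<Longrightarrow> z < s + r \<or> z = s + r + 1"
    using source[OF \<alpha> w] by blast
  show ?thesis
  proof (cases "col \<alpha> (s + r + 1) = i")
    case False
    have "fits \<alpha> i s 0" unfolding fits_def using src False by auto
    then show ?thesis using arc s by blast
  next
    case last: True
    show ?thesis
    proof (cases "col \<alpha> (s + 1) = i")
      case False
      have "fits \<alpha> i s 1"
        unfolding fits_def
      proof (intro allI impI, elim conjE)
        fix z assume z: "s \<le> z" "z < s + m" "col \<alpha> z = i"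
        have "z \<noteq> s + 1" using z(3) False by auto
        then show "z < s + r + 2 * 1 \<and> (1 = 1 \<longrightarrow> z \<noteq> s + 1 \<and> z \<noteq> s
          + r)"
          using src[OF z] by auto
      qed
      then show ?thesis using gapped s last by blast
    next
      case True
      have only: "z = s \<or> z = s + 1 \<or> z = s + r + 1"
        if z: "s \<le> z" "z < s + m" "col \<alpha> z = i" for z
      proof (rule ccontr)
        assume "\<not> ?thesis"
        then have "s + 2 \<le> z" "z < s + r" using src[OF z] z by auto
        then have "conn (z - (s + 1))" "conn (s + r + 1 - z)" "conn (s + 1 + m - (s + r + 1))"
          unfolding conn_def using m by auto
        then show False using no_triangle[OF \<alpha> True z(3) last] by blast
      qed
      show ?thesis
      \<comment> \<open>Based at \<open>p = s + r + 1\<close>, the vertices \<open>s\<close> and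
        \<open>s + 1\<close> are \<open>p + r\<close> and \<open>p + r + 1\<close> modulo
        \<open>m\<close>.\<close>
      proof (rule triple[of "s + r + 1"])
        have e: "s + r + 1 + r = s + m" using m by simp
        show "col \<alpha> (s + r + 1) = i" by fact
        show "col \<alpha> (s + r + 1 + r) = i" unfolding e using s by simp
        show "col \<alpha> (s + r + 1 + r + 1) = i"
          using True col_shift(1)[of \<alpha> "s + 1"] unfolding e by (simp add: algebra_simps)
        fix z assume z: "s + r + 1 \<le> z" "z < s + r + 1 + m" "col \<alpha> z = i"
        show "z = s + r + 1 \<or> z = s + r + 1 + r \<or> z = s + r + 1 + r + 1"
        proof (cases "z < s + m")
          case True
          then show ?thesis using only[of z] z r5 by auto
        next
          case False
          then have "s \<le> z - m" "z - m < s + m" using z(1,2) m r5 by linarith+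
          then have "z - m = s \<or> z - m = s + 1 \<or> z - m = s + r + 1"
            using only[of "z - m"] z(3) by simp
          then show ?thesis using z(1,2) m by (smt (verit))
        qed
      qed
    qed
  qed
qed

section \<open>Recolouring a single vertex\<close>

lemma col_upd:
  assumes "p \<le> z" "z < p + m" "p \<le> x" "x < p + m"
  shows "col (\<alpha>(x mod m := i)) z = (if z = x then i else col \<alpha> z)"
  unfolding col_def using mod_eq_window[OF assms] by simp

lemma col_upd_mod: "col (\<alpha>(x mod m := i)) z = (if z mod m = x mod m then i else col \<alpha> z)"
  unfolding col_def by simp

lemma upd_in: "\<alpha> \<in> V \<rightarrow>\<^sub>E {1..3} \<Longrightarrow> i \<in> {1..3}
  \<Longrightarrow> \<alpha>(x mod m := i) \<in> V \<rightarrow>\<^sub>E {1..3}"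
  using mod_in_V[of x] by (auto simp: PiE_iff extensional_def)

lemma close_upd:
  assumes "\<alpha> \<in> colorings" "\<alpha>(x mod m := i) \<in> colorings"
  shows "close \<alpha> (\<alpha>(x mod m := i)) 1"
  using assms by (intro close_one[where x = "x mod m"]) auto

lemma coloringI:
  assumes "\<alpha> \<in> V \<rightarrow>\<^sub>E {1..3}" "{a, b, c} = {1..3::nat}"
    and "fits \<alpha> a p e" "e = 0 \<or> e = 1" "fits \<alpha> b q f" "f = 0 \<or> f = 1"
      "fits \<alpha> c s g" "g = 0 \<or> g = 1"
  shows "\<alpha> \<in> colorings"
proof -
  have "acyclic (mono_arcs {x \<in> V. \<alpha> x = i})" if "i \<in> {a, b, c}" for i
    using that acyclic_fits assms(3-) by auto
  then show ?thesis unfolding colorings_iff using assms(1,2) by blast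
qed

end

section \<open>Colourings by intervals\<close>

lemma triple_eq:
  assumes "{a, b, c} = {1..3::nat}"
  shows "a \<noteq> b" "b \<noteq> c" "a \<noteq> c" "a \<in> {1..3}" "b \<in> {1..3}" "c \<in> {1..3}"
proof -
  have "card {a, b, c} = 3" unfolding assms by simp
  then show "a \<noteq> b" "b \<noteq> c" "a \<noteq> c" by (auto simp: card_insert_if split: if_splits)
  show "a \<in> {1..3}" "b \<in> {1..3}" "c \<in> {1..3}" unfolding assms[symmetric] by auto
qed

context circulant
begin

text \<open>Two inequalities instead of an equation: arithmetic can use them, while the simplifier
  does not unfold \<open>m\<close>, which would keep \<open>col_shift\<close> from matching.\<close>

lemma m_bounds: "2 * r + 1 \<le> m" "m \<le> 2 * r + 1"
  using m by simp_all

lemma col_cases: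
  assumes "\<alpha> \<in> V \<rightarrow>\<^sub>E {1..3}" "{a, b, c} = {1..3::nat}"
  shows "col \<alpha> z = a \<or> col \<alpha> z = b \<or> col \<alpha> z = c"
  using coloring_range[OF assms(1), of z] unfolding assms(2)[symmetric] by auto

text \<open>The three gaps add up to \<open>m\<close>, so windows of \<open>r\<close> vertices
  starting at \<open>x\<close>, \<open>y\<close>, \<open>z\<close> cover the cycle, every gap is at
  least 1, and the three overlaps have \<open>3 * r - m = r - 1\<close> vertices together.\<close>

definition short_gaps :: "int \<Rightarrow> int \<Rightarrow> int \<Rightarrow> bool" where
  "short_gaps x y z \<longleftrightarrow> y - x \<le> r \<and> z - y \<le> r \<and> x + m - z \<le> r"

definition contained ::
  "(int \<Rightarrow> nat) \<Rightarrow> nat \<Rightarrow> nat \<Rightarrow> nat \<Rightarrow> int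
    \<Rightarrow> int \<Rightarrow> int \<Rightarrow> bool" where
  "contained \<alpha> a b c x y z \<longleftrightarrow> \<alpha> \<in> V \<rightarrow>\<^sub>E {1..3}
    \<and> {a, b, c} = {1..3} \<and> short_gaps x y z \<and>
     fits \<alpha> a x 0 \<and> fits \<alpha> b y 0 \<and> fits \<alpha> c z 0"

lemma contained_coloring: "contained \<alpha> a b c x y z \<Longrightarrow> \<alpha> \<in> colorings"
  unfolding contained_def using coloringI[of \<alpha> a b c x 0 y 0 z 0] by simp

lemma contained_rotate:
  "contained \<alpha> a b c x y z \<Longrightarrow> contained \<alpha> b c a y z (x + m)"
  unfolding contained_def short_gaps_def using fits_shift[of \<alpha> a x 1] by (auto simp: insert_commute)

definition interval_coloring ::
  "nat \<Rightarrow> nat \<Rightarrow> nat \<Rightarrow> int \<Rightarrow> int \<Rightarrow> int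
    \<Rightarrow> int \<Rightarrow> nat" where
  "interval_coloring a b c x y z = (\<lambda>t\<in>V. let s = x + (t - x) mod m in
     if s < y then a else if s < z then b else c)"

lemma col_interval_coloring:
  assumes "x \<le> s" "s < x + m"
  shows "col (interval_coloring a b c x y z) s = (if s < y then a else if s < z then b else c)"
proof -
  have "(s mod m - x) mod m = (s - x) mod m" by (rule mod_diff_left_eq)
  then have "(s mod m - x) mod m = s - x" using assms mod_small[of "s - x"] by simp
  then show ?thesis unfolding col_def interval_coloring_def Let_def using mod_in_V by simp
qed

lemma interval_coloring_range:
  "{a, b, c} = {1..3::nat}
    \<Longrightarrow> interval_coloring a b c x y z \<in> V \<rightarrow>\<^sub>E {1..3}"
  unfolding interval_coloring_def Let_def using triple_eq[of a b c] by auto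

lemma interval_coloring_shift:
  "interval_coloring a b c (x + m) (y + m) (z + m) = interval_coloring a b c x y z"
proof -
  have "(t - (x + m)) mod m = (t - x) mod m" for t
    using mod_add_self2[of "t - (x + m)" m] by (simp add: algebra_simps)
  then show ?thesis unfolding interval_coloring_def Let_def by (intro restrict_ext) auto
qed

text \<open>The windows start at \<open>p\<close>, \<open>q\<close>, \<open>s\<close>. Each boundary
  \<open>x\<close>, \<open>y\<close>, \<open>z\<close> is confined to the overlap of the two windows
  that it separates, so every interval stays inside the window of its colour.\<close>

lemma interval_coloring_contained:
  assumes abc: "{a, b, c} = {1..3::nat}" and t: "short_gaps p q s" "short_gaps x y z"
    and x: "p \<le> x" "x \<le> s + r - m" and y: "q \<le> y" "y \<le> p + r" and z: "s \<le> z"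
      "z \<le> q + r"
  shows "contained (interval_coloring a b c x y z) a b c p q s"
proof -
  let ?f = "interval_coloring a b c x y z"
  note ne = triple_eq[OF abc]
  have q: "x < q" "q \<le> s" "y \<le> z" "z < x + m" "x \<le> p + m"
    using x y z t m_bounds r5 unfolding short_gaps_def by linarith+
  have a: "fits ?f a p 0"
    unfolding fits_def
  proof (intro allI impI, elim conjE)
    fix w assume w: "p \<le> w" "w < p + m" "col ?f w = a"
    show "w < p + r + 2 * 0 \<and> (0 = (1::int) \<longrightarrow> w \<noteq> p + 1 \<and> w \<noteq> p + r)"
    proof (cases "x \<le> w")
      case True
      then have "w < y" using w x col_interval_coloring[of x w a b c y z] ne by (auto split: if_splits)
      then show ?thesis using y by simp
    next
      case False
      then have "w + m < y"
        using w x col_interval_coloring[of x "w + m" a b c y z] ne q by (auto split: if_splits)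
      then show ?thesis using w y m_bounds r5 by linarith
    qed
  qed
  have b: "fits ?f b q 0"
    unfolding fits_def
  proof (intro allI impI, elim conjE)
    fix w assume w: "q \<le> w" "w < q + m" "col ?f w = b"
    show "w < q + r + 2 * 0 \<and> (0 = (1::int) \<longrightarrow> w \<noteq> q + 1 \<and> w \<noteq> q + r)"
    proof (cases "w < x + m")
      case True
      then have "w < z" using w q col_interval_coloring[of x w a b c y z] ne by (auto split: if_splits)
      then show ?thesis using z by simp
    next
      case False
      then have "y \<le> w - m"
        using w q col_interval_coloring[of x "w - m" a b c y z] ne x y z t
        by (auto simp: short_gaps_def split: if_splits)
      then show ?thesis using w y by simp
    qed
  qed
  have c: "fits ?f c s 0"
    unfolding fits_def
  proof (intro allI impI, elim conjE)
    fix w assume w: "s \<le> w" "w < s + m" "col ?f w = c"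
    show "w < s + r + 2 * 0 \<and> (0 = (1::int) \<longrightarrow> w \<noteq> s + 1 \<and> w \<noteq> s + r)"
    proof (cases "w < x + m")
      case True
      then show ?thesis using x by simp
    next
      case False
      then have "z \<le> w - m"
        using w q col_interval_coloring[of x "w - m" a b c y z] ne x y z t
        by (auto simp: short_gaps_def split: if_splits)
      then show ?thesis using w z by simp
    qed
  qed
  show ?thesis
    unfolding contained_def using abc t(1) a b c interval_coloring_range[OF abc] by blast
qed

lemma interval_coloring_valid:
  assumes "{a, b, c} = {1..3::nat}" "short_gaps x y z"
  shows "interval_coloring a b c x y z \<in> colorings"
  using assms by (intro contained_coloring[OF interval_coloring_contained[of a b c x y z x y z]])
    (auto simp: short_gaps_def)

text \<open>Any mixture of the two colourings respects the same windows and is therefore valid, so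
  the differing vertices can be recoloured one by one.\<close>

lemma close_same_containers:
  assumes "contained \<alpha> a b c x y z" "contained \<beta> a b c x y z"
  shows "close \<alpha> \<beta> (int (card {t \<in> V. \<alpha> t \<noteq> \<beta> t}))"
  using assms(1)
proof (induction "card {t \<in> V. \<alpha> t \<noteq> \<beta> t}" arbitrary: \<alpha>)
  case 0
  then have "{t \<in> V. \<alpha> t \<noteq> \<beta> t} = {}" using finite_V by simp
  then have "\<alpha> = \<beta>"
    using 0(2) assms(2) unfolding contained_def by (intro PiE_ext[of \<alpha> V "\<lambda>_. {1..3}"]) auto
  then show ?case using contained_coloring[OF 0(2)] close_refl by simp
next
  case (Suc k)
  then have "{t \<in> V. \<alpha> t \<noteq> \<beta> t} \<noteq> {}" by (metis card.empty nat.distinct(1))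
  then obtain t where t: "t \<in> V" "\<alpha> t \<noteq> \<beta> t" by blast
  let ?\<gamma> = "\<alpha>(t := \<beta> t)"
  have tm: "t mod m = t" using t(1) unfolding V_def by simp
  have fit: "fits ?\<gamma> i p 0" if "fits \<alpha> i p 0" "fits \<beta> i p 0" for i p
    using that unfolding fits_def col_def by auto
  have "?\<gamma> \<in> V \<rightarrow>\<^sub>E {1..3}"
    using Suc(3) assms(2) t(1) unfolding contained_def by (auto simp: PiE_iff extensional_def)
  then have \<gamma>: "contained ?\<gamma> a b c x y z"
    using Suc(3) assms(2) fit unfolding contained_def by blast
  have "{s \<in> V. ?\<gamma> s \<noteq> \<beta> s} = {s \<in> V. \<alpha> s \<noteq> \<beta> s} - {t}"
    by auto
  then have "k = card {s \<in> V. ?\<gamma> s \<noteq> \<beta> s}"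
    using Suc(2) t finite_V by simp
  then have "close ?\<gamma> \<beta> (int k)" using Suc(1)[OF _ \<gamma>] by metis
  moreover have "close \<alpha> ?\<gamma> 1"
    using close_upd[of \<alpha> t "\<beta> t"] contained_coloring[OF \<gamma>]
    contained_coloring[OF Suc(3)] unfolding tm by blast
  ultimately have "close \<alpha> \<beta> (1 + int k)" by (rule within_dist_trans[rotated])
  then show ?case using Suc(2)[symmetric] by simp
qed

section \<open>Counting colours in windows\<close>

definition count :: "(int \<Rightarrow> nat) \<Rightarrow> nat \<Rightarrow> int \<Rightarrow> int
  \<Rightarrow> int" where
  "count \<alpha> i x y = int (card {z \<in> {x..<y}. col \<alpha> z = i})"

lemma finite_window [simp]: "finite {z. x \<le> z \<and> z < y \<and> P z}" for x y :: int
  by (rule finite_subset[of _ "{x..<y}"]) auto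

lemma count_nonneg: "0 \<le> count \<alpha> i x y"
  unfolding count_def by simp

lemma count_split:
  assumes "x \<le> y" "y \<le> z"
  shows "count \<alpha> i x z = count \<alpha> i x y + count \<alpha> i y z"
proof -
  have "{w \<in> {x..<z}. col \<alpha> w = i} = {w \<in> {x..<y}. col \<alpha> w
    = i} \<union> {w \<in> {y..<z}. col \<alpha> w = i}"
    using assms by auto
  moreover have "card \<dots> = card {w \<in> {x..<y}. col \<alpha> w = i}
    + card {w \<in> {y..<z}. col \<alpha> w = i}"
    by (intro card_Un_disjoint) auto
  ultimately show ?thesis unfolding count_def by simp
qed

lemma count_two:
  assumes "x \<le> y" "i \<noteq> j"
    "\<And>z. x \<le> z \<Longrightarrow> z < y \<Longrightarrow> col \<alpha> z = i \<or> col \<alpha> z = j"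
  shows "count \<alpha> i x y + count \<alpha> j x y = y - x"
proof -
  have "\<forall>w\<in>{x..<y}. col \<alpha> w = i \<or> col \<alpha> w = j" using assms(3) by simp
  then have "{x..<y} = {w \<in> {x..<y}. col \<alpha> w = i} \<union> {w \<in> {x..<y}. col \<alpha> w
    = j}" by blast
  moreover have "card \<dots> = card {w \<in> {x..<y}. col \<alpha> w = i}
    + card {w \<in> {x..<y}. col \<alpha> w = j}"
    using assms(2) by (intro card_Un_disjoint) auto
  ultimately have "card {x..<y} = card {w \<in> {x..<y}. col \<alpha> w = i}
    + card {w \<in> {x..<y}. col \<alpha> w = j}"
    by (rule trans[OF arg_cong[of _ _ card]])
  moreover have "int (card {x..<y}) = y - x" using assms(1) by simp
  ultimately show ?thesis unfolding count_def by linarith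
qed

lemma count_all:
  assumes "x \<le> y" "\<And>z. x \<le> z \<Longrightarrow> z < y \<Longrightarrow> col \<alpha> z = i"
  shows "count \<alpha> i x y = y - x"
proof -
  have "\<forall>w\<in>{x..<y}. col \<alpha> w = i" using assms(2) by simp
  then have "{w \<in> {x..<y}. col \<alpha> w = i} = {x..<y}" by blast
  then show ?thesis unfolding count_def using assms(1) by simp
qed

text \<open>A vertex can only have a colour whose window contains it: two colours compete inside an
  overlap, and one colour is forced between consecutive overlaps.\<close>

lemma contained_zone:
  assumes f: "contained \<alpha> a b c x y z"
  shows "y \<le> w \<Longrightarrow> w < x + r \<Longrightarrow> col \<alpha> w = a \<or> col \<alpha> w = b"
    and "z + r - m \<le> w \<Longrightarrow> w < y \<Longrightarrow> col \<alpha> w = a"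
proof -
  have abc: "{a, b, c} = {1..3}" and rng: "\<alpha> \<in> V \<rightarrow>\<^sub>E {1..3}" and t:
    "short_gaps x y z"
    and fa: "fits \<alpha> a x 0" and fb: "fits \<alpha> b y 0" and fc: "fits \<alpha> c z 0"
    using f unfolding contained_def by auto
  note cs = col_cases[OF rng abc, of w]
  show "col \<alpha> w = a \<or> col \<alpha> w = b" if "y \<le> w" "w < x + r"
    using cs fitsD(1)[OF fc, of "w + m"] that t m_bounds r5 unfolding short_gaps_def by auto
  show "col \<alpha> w = a" if "z + r - m \<le> w" "w < y"
    using cs fitsD(1)[OF fc, of "w + m"] fitsD(1)[OF fb, of "w + m"] that t m_bounds r5
    unfolding short_gaps_def by auto
qed

text \<open>Sharpening a boundary at one end of its overlap recolours only those vertices of the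
  overlap that have the colour to be erased. The two colourings share their windows, so the number
  of differences bounds the distance.\<close>

lemma close_contained_interval:
  assumes f: "contained \<alpha> a b c x y z"
    and 1: "x' = x \<and> k1 = count \<alpha> c x (z + r - m) \<or> x' = z + r - m \<and> k1
      = count \<alpha> a x (z + r - m)"
    and 2: "y' = y \<and> k2 = count \<alpha> a y (x + r) \<or> y' = x + r \<and> k2
      = count \<alpha> b y (x + r)"
    and 3: "z' = z \<and> k3 = count \<alpha> b z (y + r) \<or> z' = y + r \<and> k3
      = count \<alpha> c z (y + r)"
  shows "short_gaps x' y' z'" "close \<alpha> (interval_coloring a b c x' y' z') (k1 + k2 + k3)"
proof -
  have abc: "{a, b, c} = {1..3}" and rng: "\<alpha> \<in> V \<rightarrow>\<^sub>E {1..3}" and t: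
    "short_gaps x y z"
    using f unfolding contained_def by auto
  note ne = triple_eq[OF abc]
  let ?g = "interval_coloring a b c x' y' z'"
  show t': "short_gaps x' y' z'" using 1 2 3 t m_bounds unfolding short_gaps_def by auto
  have g: "contained ?g a b c x y z"
    using 1 2 3 t by (intro interval_coloring_contained abc t t') (auto simp: short_gaps_def)
  \<comment> \<open>\<open>i1\<close>, \<open>i2\<close>, \<open>i3\<close> are the colours erased
    from the three overlaps, one for each choice of an end.\<close>
  obtain i1 i2 i3 where i: "k1 = count \<alpha> i1 x (z + r - m)"
    "x' = x \<and> i1 = c \<or> x' = z + r - m \<and> i1 = a"
      "k2 = count \<alpha> i2 y (x + r)" "y' = y \<and> i2 = a \<or> y' = x + r \<and> i2 = b"
      "k3 = count \<alpha> i3 z (y + r)" "z' = z \<and> i3 = b \<or> z' = y + r \<and> i3 = c"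
    using 1 2 3 by blast
  let ?S1 = "{w \<in> {x..<z + r - m}. col \<alpha> w = i1}"
  let ?S2 = "{w \<in> {y..<x + r}. col \<alpha> w = i2}"
  let ?S3 = "{w \<in> {z..<y + r}. col \<alpha> w = i3}"
  note f2 = contained_rotate[OF f]
  note f3 = contained_rotate[OF f2]
  have "{t \<in> V. \<alpha> t \<noteq> ?g t} \<subseteq> (\<lambda>w. w mod m) ` (?S1 \<union> ?S2
    \<union> ?S3)"
  proof
    fix s assume s: "s \<in> {t \<in> V. \<alpha> t \<noteq> ?g t}"
    obtain w where w: "x \<le> w" "w < x + m" "w mod m = s mod m"
      using residue_window[OF m_pos] by blast
    have ws: "w mod m = s" using s w(3) unfolding V_def by simp
    then have neq: "col \<alpha> w \<noteq> col ?g w" using s unfolding col_def by simp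
    have "w \<in> ?S1 \<union> ?S2 \<union> ?S3"
    proof -
      \<comment> \<open>Once around the cycle: the three overlaps alternate with the three forced
        zones.\<close>
      consider "w < z + r - m" | "z + r - m \<le> w" "w < y" | "y \<le> w" "w < x + r"
        | "x + r \<le> w" "w < z" | "z \<le> w" "w < y + r" | "y + r \<le> w" by linarith
      then show ?thesis
      proof cases
        case 1
        have A: "col \<alpha> w = c \<or> col \<alpha> w = a"
          using contained_zone(1)[OF f3, of "w + m"] 1 w t m_bounds by (auto simp: short_gaps_def)
        have G: "col ?g w = (if w < x' then c else a)"
          using col_interval_coloring[of x' w a b c y' z']
          col_interval_coloring[of x' "w + m" a b c y' z'] 1 w t' i(2,4,6) t m_bounds
          by (auto simp: short_gaps_def)
        show ?thesis using A G i(2) 1 w neq by (auto split: if_splits)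
      next
        case 2
        have "col \<alpha> w = a" using contained_zone(2)[OF f] 2 by blast
        moreover have "col ?g w = a"
          using col_interval_coloring[of x' w a b c y' z'] 2 w t' i(2,4,6) t m_bounds
          by (auto simp: short_gaps_def)
        ultimately show ?thesis using neq by simp
      next
        case 3
        have A: "col \<alpha> w = a \<or> col \<alpha> w = b" using contained_zone(1)[OF f] 3 by blast
        have G: "col ?g w = (if w < y' then a else b)"
          using col_interval_coloring[of x' w a b c y' z'] 3 w t' i(2,4,6) t m_bounds
          by (auto simp: short_gaps_def)
        show ?thesis using A G i(4) 3 w neq by (auto split: if_splits)
      next
        case 4
        have "col \<alpha> w = b" using contained_zone(2)[OF f2, of w] 4 by (simp add: algebra_simps)
        moreover have "col ?g w = b"
          using col_interval_coloring[of x' w a b c y' z'] 4 w t' i(2,4,6) t m_bounds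
          by (auto simp: short_gaps_def)
        ultimately show ?thesis using neq by simp
      next
        case 5
        have A: "col \<alpha> w = b \<or> col \<alpha> w = c" using contained_zone(1)[OF f2] 5 by blast
        have G: "col ?g w = (if w < z' then b else c)"
          using col_interval_coloring[of x' w a b c y' z'] 5 w t' i(2,4,6) t m_bounds
          by (auto simp: short_gaps_def)
        show ?thesis using A G i(6) 5 w neq by (auto split: if_splits)
      next
        case 6
        have "col \<alpha> w = c" using contained_zone(2)[OF f3, of w] 6 w by simp
        moreover have "col ?g w = c"
          using col_interval_coloring[of x' w a b c y' z'] 6 w t' i(2,4,6) t m_bounds
          by (auto simp: short_gaps_def)
        ultimately show ?thesis using neq by simp
      qed
    qed
    then show "s \<in> (\<lambda>w. w mod m) ` (?S1 \<union> ?S2 \<union> ?S3)" using ws by blast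
  qed
  then have "card {t \<in> V. \<alpha> t \<noteq> ?g t} \<le> card (?S1 \<union> ?S2 \<union> ?S3)"
    by (intro surj_card_le) simp_all
  also have "\<dots> \<le> card ?S1 + card ?S2 + card ?S3"
    using card_Un_le[of "?S1 \<union> ?S2" ?S3] card_Un_le[of ?S1 ?S2] by linarith
  finally have "int (card {t \<in> V. \<alpha> t \<noteq> ?g t}) \<le> k1 + k2 + k3"
    unfolding i(1,3,5) count_def by linarith
  then show "close \<alpha> ?g (k1 + k2 + k3)"
    by (rule within_dist_mono[OF close_same_containers[OF f g]])
qed

lemma close_interval_step:
  assumes abc: "{a, b, c} = {1..3::nat}" and t: "short_gaps x y z" "short_gaps x' y' z'"
    and s: "x' = x + 1 \<and> y' = y \<and> z' = z \<or> x' = x \<and> y' = y + 1 \<and> z' = z \<or> x'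
      = x \<and> y' = y \<and> z' = z + 1"
  shows "close (interval_coloring a b c x y z) (interval_coloring a b c x' y' z') 1"
proof (rule close_one)
  show "interval_coloring a b c x y z \<in> colorings" "interval_coloring a b c x' y' z' \<in> colorings"
    using interval_coloring_valid abc t by blast+
  let ?p = "if x' = x + 1 then x else if y' = y + 1 then y else z"
  fix u assume u: "u \<in> V" "u \<noteq> ?p mod m"
  obtain w where w: "x \<le> w" "w < x + m" "w mod m = u mod m"
    using residue_window[OF m_pos] by blast
  have wu: "w mod m = u" using u w(3) unfolding V_def by simp
  then have "w \<noteq> ?p" using u(2) by auto
  then have "col (interval_coloring a b c x y z) w = col (interval_coloring a b c x' y' z') w"
    using s w col_interval_coloring[of x w a b c y z] col_interval_coloring[of x' w a b c y' z']
    by (auto split: if_splits)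
  then show "interval_coloring a b c x y z u = interval_coloring a b c x' y' z' u"
    unfolding col_def wu .
qed

text \<open>A boundary that still has to rise can be blocked only by a gap of length
  \<open>r\<close> behind it, and then the previous boundary has to rise as well. If all three were
  blocked, the gaps would add up to \<open>3 * r > m\<close>.\<close>

lemma close_interval_up:
  assumes abc: "{a, b, c} = {1..3::nat}"
  shows "short_gaps x y z \<Longrightarrow> short_gaps x' y' z' \<Longrightarrow> x \<le> x'
    \<Longrightarrow> y \<le> y' \<Longrightarrow> z \<le> z' \<Longrightarrow>
    close (interval_coloring a b c x y z) (interval_coloring a b c x' y' z') (x' - x + (y' - y) + (z' - z))"
proof (induction "nat (x' - x + (y' - y) + (z' - z))" arbitrary: x y z)
  case 0
  then have "x' = x" "y' = y" "z' = z" by auto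
  then show ?case using 0 close_refl interval_coloring_valid abc by simp
next
  case (Suc k)
  have step: ?case if "short_gaps p q s" "p \<le> x'" "q \<le> y'" "s \<le> z'"
    "p = x + 1 \<and> q = y \<and> s = z \<or> p = x \<and> q = y + 1 \<and> s = z \<or> p = x \<and> q
      = y \<and> s = z + 1" for p q s
  proof -
    have "close (interval_coloring a b c p q s) (interval_coloring a b c x' y' z') (x' - p + (y' - q)
      + (z' - s))"
      using that Suc by (intro Suc(1)) auto
    from within_dist_trans[OF close_interval_step[OF abc Suc(3) that(1,5)] this]
    show ?thesis by (rule within_dist_mono) (use that in auto)
  qed
  consider "x < x'" "short_gaps (x + 1) y z" | "y < y'" "short_gaps x (y + 1) z" | "z < z'"
    "short_gaps x y (z + 1)"
    using Suc(2-7) m_bounds r5 unfolding short_gaps_def by linarith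
  then show ?case using step[of "x + 1" y z] step[of x "y + 1" z] step[of x y "z + 1"] Suc
    by cases auto
qed

text \<open>The detour through the componentwise minimum costs nothing extra, and bounds on
  differences survive taking minima.\<close>

lemma close_interval:
  assumes abc: "{a, b, c} = {1..3::nat}" and t: "short_gaps x y z" "short_gaps x' y' z'"
  shows "close (interval_coloring a b c x y z) (interval_coloring a b c x' y' z') (\<bar>x - x'\<bar>
    + \<bar>y - y'\<bar> + \<bar>z - z'\<bar>)"
proof -
  let ?x = "min x x'" and ?y = "min y y'" and ?z = "min z z'"
  have m: "short_gaps ?x ?y ?z" using t unfolding short_gaps_def by linarith
  from within_dist_trans[OF close_sym[OF close_interval_up[OF abc m t(1)]] close_interval_up[OF abc m t(2)]]
  show ?thesis by (rule within_dist_mono) auto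
qed

section \<open>Hubs and their distance from colourings in windows\<close>

definition hub :: "nat \<Rightarrow> nat \<Rightarrow> nat \<Rightarrow> int \<Rightarrow> int
  \<Rightarrow> nat" where
  "hub a b c t = interval_coloring a b c t (t + 1) (t + r + 1)"

lemma short_gaps_hub: "short_gaps t (t + 1) (t + r + 1)"
  unfolding short_gaps_def using m_bounds r5 by simp

lemma hub_valid: "{a, b, c} = {1..3::nat} \<Longrightarrow> hub a b c t \<in> colorings"
  unfolding hub_def using interval_coloring_valid short_gaps_hub by blast

lemma hub_shift: "hub a b c (t + m) = hub a b c t"
  unfolding hub_def using interval_coloring_shift[of a b c t "t + 1" "t + r + 1"]
  by (simp add: algebra_simps)

lemma col_hub:
  "t \<le> w \<Longrightarrow> w < t + m \<Longrightarrow>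
    col (hub a b c t) w = (if w = t then a else if w \<le> t + r then b else c)"
  unfolding hub_def using col_interval_coloring[of t w a b c "t + 1" "t + r + 1"] by auto

lemma close_hub:
  assumes f: "contained \<alpha> a b c x y z"
    and "x' = x \<and> k1 = count \<alpha> c x (z + r - m) \<or> x' = z + r - m \<and> k1
      = count \<alpha> a x (z + r - m)"
    and "y' = y \<and> k2 = count \<alpha> a y (x + r) \<or> y' = x + r \<and> k2 = count \<alpha> b y (x
      + r)"
    and "z' = z \<and> k3 = count \<alpha> b z (y + r) \<or> z' = y + r \<and> k3 = count \<alpha> c z (y
      + r)"
  shows "close \<alpha> (hub a b c t) (k1 + k2 + k3 + \<bar>x' - t\<bar> + \<bar>y' - (t + 1)\<bar>
    + \<bar>z' - (t + r + 1)\<bar>)"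
proof -
  have abc: "{a, b, c} = {1..3}" using f unfolding contained_def by auto
  note i = close_contained_interval[OF assms]
  from within_dist_trans[OF i(2) close_interval[OF abc i(1) short_gaps_hub[of t]]]
  show ?thesis unfolding hub_def by (rule within_dist_mono) simp
qed

end

section \<open>Rotating a hub towards a colouring\<close>

text \<open>\<open>D t k\<close> says that the hub rotated by \<open>t\<close> is within distance \<open>k\<close> of the target. The overlaps of
  the target's windows have \<open>o1\<close>, \<open>o2\<close>, \<open>o3\<close> vertices. While the hub rotates from \<open>0\<close> to
  \<open>r - 1\<close>, its three boundaries cross these overlaps one after the other, in the order \<open>o1\<close>,
  \<open>o3\<close>, \<open>o2\<close>. Before \<open>0\<close> and after \<open>r - 1\<close> the distance is linear in \<open>t\<close>. The source offers
  the rotations \<open>t\<close> and \<open>t + u + v + \<epsilon>\<close>, at extra costs \<open>u\<close> and \<open>v\<close>.\<close>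

lemma rotating_hub_bound:
  fixes D :: "int \<Rightarrow> int \<Rightarrow> bool" and r m :: int
  assumes r: "5 \<le> r" and m: "m = 2 * r + 1"
    and mono: "\<And>t k l. D t k \<Longrightarrow> k \<le> l \<Longrightarrow> D t l"
    and per: "\<And>t k. D (t + m) k \<longleftrightarrow> D t k"
    and uv: "0 \<le> u1" "0 \<le> u2" "0 \<le> u3" "0 \<le> v1" "0 \<le> v2" "0 \<le> v3"
    and o: "u1 + v1 = o1" "u2 + v2 = o2" "u3 + v3 = o3" "o1 + o2 + o3 = r - 1"
    and e: "0 \<le> e" "e \<le> 1" "0 \<le> f" "f \<le> 1" "0 \<le> g" "g \<le> 1"
    and gap: "2 * e \<le> o1" "2 * f \<le> o2" "2 * g \<le> o3"
    and up: "\<And>t q1 k1 q2 k2 q3 k3. q1 = 0 \<and> k1 = u1 \<or> q1 = o1 \<and> k1 = v1 \<Longrightarrow>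
      q2 = o1 + o3 \<and> k2 = u2 \<or> q2 = r - 1 \<and> k2 = v2 \<Longrightarrow>
      q3 = o1 \<and> k3 = u3 \<or> q3 = o1 + o3 \<and> k3 = v3 \<Longrightarrow>
      D t (k1 + k2 + k3 + \<bar>q1 - t\<bar> + \<bar>q2 - t\<bar> + \<bar>q3 - t\<bar> + (e + f + g))"
    and down: "\<And>t. D t (r - 1 - (u1 + u2 + u3) + \<bar>o1 + 2 * g - t\<bar> + \<bar>r - 1
      + 2 * e - t\<bar>
      + \<bar>o1 + o3 + 2 * f - t\<bar> + (e + f + g))"
    and src: "0 \<le> u" "0 \<le> v" "3 * (u + v + 1) \<le> m" "\<epsilon> = 0 \<or> \<epsilon> = 1"
  shows "D t (3 * r + 1 - \<epsilon> - u) \<or> D (t + u + v + \<epsilon>) (3 * r + 1 - \<epsilon> - v)"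
proof (rule ccontr)
  define N F where "N = r - 1" and "F = e + f + g"
  \<comment> \<open>\<kappa> is the cost at position 0 with all boundaries sharpened at their left
    ends, \<nu> the cost at position \<open>N\<close> with all of them sharpened at their right
    ends. Both include the \<open>F\<close> repairs.\<close>
  define \<kappa> where "\<kappa> = u1 + u2 + u3 + 2 * o1 + o3 + F"
  define \<nu> where "\<nu> = v1 + v2 + v3 + 2 * o2 + o3 + F"
  assume "\<not> ?thesis"
  then have no: "\<not> D t (3 * r + 1 - \<epsilon> - u)"
    "\<not> D (t + u + v + \<epsilon>) (3 * r + 1 - \<epsilon> - v)"
    by auto
  have per': "D (t + j * m) k \<longleftrightarrow> D t k" for t k and j :: int
  proof (induction j rule: int_induct[where k = 0])
    case (step1 i)
    then show ?case using per[of "t + i * m" k] by (simp add: algebra_simps)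
  next
    case (step2 i)
    then show ?case using per[of "t + (i - 1) * m" k] by (simp add: algebra_simps)
  qed simp
  \<comment> \<open>The representative of \<open>t\<close> among the \<open>m\<close> positions
    below \<open>N + 2 * e\<close>, so that \<open>a + m\<close> lies where \<open>above\<close>
    applies.\<close>
  define a where "a = N + 2 * e - m + (t - (N + 2 * e)) mod m"
  define b where "b = a + u + v + \<epsilon>"
  have "0 < m" using m r by simp
  then have "0 \<le> (t - (N + 2 * e)) mod m" "(t - (N + 2 * e)) mod m < m" by simp_all
  then have ab: "N + 2 * e - m \<le> a" "a < N + 2 * e" unfolding a_def by linarith+
  obtain j where j: "a = t + j * m"
  proof
    have "(t - (N + 2 * e)) mod m = t - (N + 2 * e) - m * ((t - (N + 2 * e)) div m)"
      by (simp add: minus_mult_div_eq_mod)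
    then show "a = t + (- 1 - (t - (N + 2 * e)) div m) * m"
      unfolding a_def by (simp add: algebra_simps)
  qed
  have L: "3 * r + 1 - \<epsilon> - u < B" if "D a B" for B
  proof (rule ccontr)
    assume "\<not> ?thesis"
    then have "D a (3 * r + 1 - \<epsilon> - u)" using mono[OF that] by simp
    then show False using no(1) per' unfolding j by blast
  qed
  have R: "3 * r + 1 - \<epsilon> - v < B" if "D b B" for B
  proof (rule ccontr)
    assume "\<not> ?thesis"
    then have "D b (3 * r + 1 - \<epsilon> - v)" using mono[OF that] by simp
    moreover have "b = t + u + v + \<epsilon> + j * m" unfolding b_def j by simp
    ultimately show False using no(2) per' by metis
  qed
  have L': "3 * r + 1 - \<epsilon> - u < B" if "D (a + m) B" for B using L per that by blast
  have R': "3 * r + 1 - \<epsilon> - v < B" if "D (b - m) B" for B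
    using R per[of "b - m"] that by simp
  have below: "D t (\<kappa> - 3 * t)" if "t \<le> 0" for t
    using up[of 0 u1 "o1 + o3" u2 o1 u3 t] uv o that
    by (auto simp: \<kappa>_def F_def elim!: mono)
  \<comment> \<open>The repairs in \<open>down\<close> cost \<open>F\<close> but move the right ends
    by \<open>2 * F\<close> in total towards the hub. This yields exactly the constant \<kappa> of
    \<open>below\<close>; the bound \<open>above'\<close>, with the repairs of \<open>up\<close>, is
    weaker by \<open>2 * F\<close>.\<close>
  have above: "D t (3 * t - \<kappa>)" if "N + 2 * e \<le> t" for t
    by (rule mono[OF down[of t]])
      (use uv o e gap that in \<open>auto simp: \<kappa>_def F_def N_def abs_if\<close>)
  have above': "D t (\<nu> + 3 * (t - N))" if "N \<le> t" for t
    using up[of o1 v1 N v2 "o1 + o3" v3 t] uv o that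
    by (auto simp: \<nu>_def F_def N_def elim!: mono)
  have zone1: "D t (\<kappa> - t)" if "0 \<le> t" "t \<le> o1" for t
    using up[of 0 u1 "o1 + o3" u2 o1 u3 t] uv o that
    by (auto simp: \<kappa>_def F_def elim!: mono)
  have zone2: "D t (\<nu> - (N - t))" if "o1 + o3 \<le> t" "t \<le> N" for t
    using up[of o1 v1 N v2 "o1 + o3" v3 t] uv o that
    by (auto simp: \<nu>_def F_def N_def elim!: mono)
  \<comment> \<open>The two ways of sharpening the third boundary cost \<open>2 * o3\<close>
    together, so one of them costs at most \<open>o3\<close>.\<close>
  have zone3: "D t (2 * o3 + v1 + u2 + F)" if t: "o1 \<le> t" "t \<le> o1 + o3" for t
  proof (cases "u3 + (t - o1) \<le> o3")
    case True
    then show ?thesis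
      using up[of o1 v1 "o1 + o3" u2 o1 u3 t] uv o t by (auto simp: F_def elim!: mono)
  next
    case False
    then show ?thesis
      using up[of o1 v1 "o1 + o3" u2 "o1 + o3" v3 t] uv o t by (auto simp: F_def elim!: mono)
  qed
  have F: "2 * F \<le> N" "0 \<le> F" using gap(1-3) o(4) e F_def N_def by simp_all
  have sum: "\<kappa> + \<nu> = 3 * N + 2 * F"
    using o unfolding \<kappa>_def \<nu>_def N_def by simp
  have \<kappa>: "\<kappa> \<le> 3 * N - o3 - 2 * o2 + F" and \<nu>: "\<nu> \<le> 3 * N - 2 * o1 - o3 + F"
    using o uv unfolding \<kappa>_def \<nu>_def N_def by simp_all
  \<comment> \<open>Inside the overlap \<open>o3\<close> one hub alone suffices:
    \<open>2 * N + 1\<close> is \<open>2 * r - 1\<close>, and \<open>u\<close>, \<open>v\<close> are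
    below \<open>m / 3\<close>.\<close>
  have z3: "2 * o3 + v1 + u2 + F \<le> 2 * N + 1"
    using o uv gap(1,2) e(6) unfolding F_def N_def by simp
  have f: "2 * F \<le> o1 + o3 + 2" using gap e unfolding F_def by simp
  have o0: "0 \<le> o1" "0 \<le> o2" "0 \<le> o3" using uv o by simp_all
  have f2: "2 * F \<le> o3 + o2 + 2" using gap e unfolding F_def by simp
  have rN: "r = N + 1" unfolding N_def by simp
  have eps: "0 \<le> \<epsilon>" "\<epsilon> \<le> 1" using src(4) by auto
  have am: "N + 2 * e \<le> a + m" using ab by linarith
  \<comment> \<open>The bounds on the cost change form at 0, \<open>o1\<close>,
    \<open>o1 + o3\<close> and \<open>N\<close>; the cases locate both hubs relative to these
    positions.\<close>
  consider "b \<le> 0" | "a < 0" "0 < b" "b \<le> o1" | "a < 0" "o1 \<le> b" "b \<le> o1 + o3"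
    | "a < 0" "o1 + o3 \<le> b" "b \<le> N" | "a < 0" "N \<le> b"
    | "0 \<le> a" "a \<le> o1" "b \<le> o1" | "0 \<le> a" "o1 \<le> b" "b \<le> o1 + o3"
    | "0 \<le> a" "a \<le> o1" "o1 + o3 \<le> b" "b \<le> N" | "0 \<le> a" "a \<le> o1" "N \<le> b"
    | "o1 \<le> a" "a \<le> o1 + o3" | "o1 + o3 \<le> a" "b \<le> N" | "o1 + o3 \<le> a" "a < N" "N < b"
    | "N \<le> a"
    by (meson linorder_le_cases linorder_le_less_linear)
  then show False
  proof cases
    case 1
    \<comment> \<open>The typical balance: going up from \<open>b\<close> and down from
      \<open>a + m\<close> costs \<open>3 * m - 3 * (b - a)\<close> together, whereas failure of
      both would require at least \<open>6 * r + 4 - 2 * \<epsilon> - u - v\<close>.\<close>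
    from R[OF below[OF this]] L'[OF above[OF am]] show False using 1 eps b_def m src(1,2) by (smt (verit))
  next
    case 2
    have "0 \<le> b" using 2 by simp
    from R[OF zone1[OF this 2(3)]] L'[OF above[OF am]] show False using 2 eps b_def m src(1,2)
      by (smt (verit))
  next
    case 3
    from R[OF zone3[OF 3(2,3)]] show False using 3 eps z3 rN src(1-3) m r by (smt (verit))
  next
    case 4
    from R[OF zone2[OF 4(2,3)]] L[OF below[OF less_imp_le[OF 4(1)]]] show False
      using 4 eps o0 sum rN src(1-3) m r F b_def by (smt (verit))
  next
    case 5
    from R[OF above'[OF 5(2)]] L[OF below[OF less_imp_le[OF 5(1)]]] show False
      using 5 eps sum rN src(1-3) m r F b_def by (smt (verit))
  next
    case 6
    have "0 \<le> b" using 6 src(1,2) eps b_def by (smt (verit))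
    from R[OF zone1[OF this 6(3)]] show False using 6 eps \<kappa> f2 rN src(1,2) b_def o0 by (smt (verit))
  next
    case 7
    from R[OF zone3[OF 7(2,3)]] show False using 7 eps z3 rN src(1-3) m r by (smt (verit))
  next
    case 8
    from R[OF zone2[OF 8(3,4)]] L[OF zone1[OF 8(1,2)]] show False using 8 eps sum rN src(1-3) m r F b_def
      by (smt (verit))
  next
    case 9
    from R[OF above'[OF 9(3)]] L[OF zone1[OF 9(1,2)]] show False
      using 9 eps sum rN src(1-3) m r F b_def o0 o(4) by (smt (verit))
  next
    case 10
    from L[OF zone3[OF 10]] show False using 10 eps z3 rN src(1-3) m r by (smt (verit))
  next
    case 11
    have "a \<le> N" using 11 src(1,2) eps b_def by (smt (verit))
    from L[OF zone2[OF 11(1) this]] show False using 11 eps \<nu> f rN src(1,2) b_def o0 by (smt (verit))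
  next
    case 12
    \<comment> \<open>The second hub has left the overlaps at the top and is compared with the
      target from below, one turn earlier.\<close>
    have "b - m \<le> 0" using 12 eps src(1-3) m r rN b_def e(1,2) by (smt (verit))
    from L[OF zone2[OF 12(1)]] R'[OF below[OF this]] show False
      using 12 eps sum \<nu> f rN src(1-3) m b_def o0 by (smt (verit))
  next
    case 13
    have "b - m \<le> 0" using 13 ab(2) eps src(1-3) m r rN b_def e(1,2) by (smt (verit))
    from L[OF above'[OF 13]] R'[OF below[OF this]] show False
      using 13 ab(2) gap(1) eps sum \<nu> f rN src(1-3) m b_def o0 e by (smt (verit))
  qed
qed

section \<open>Hubs\<close>

context circulant
begin

text \<open>First a vertex \<open>s\<close> opposite to \<open>t\<close> also receives colour
  \<open>a\<close>: the class \<open>{t, s}\<close> is acyclic and the other classes only shrink.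
  Then \<open>t\<close> goes to the class that lost \<open>s\<close>, which leaves a hub at
  \<open>s\<close> with the other two classes interchanged.\<close>

lemma hub_swap:
  assumes abc: "{a, b, c} = {1..3::nat}"
  shows "close (hub a b c t) (hub a c b (t + r)) 2"
    and "close (hub a b c t) (hub a c b (t + r + 1)) 2"
proof -
  note ne = triple_eq[OF abc]
  have acb: "{a, c, b} = {1..3}" using abc by (simp add: insert_commute)
  have swap: "close (hub a b c t) (hub a c b s) 2" if s: "s = t + r \<or> s = t + r + 1" for s
  proof -
    let ?\<gamma> = "(hub a b c t)(s mod m := a)"
    have \<gamma>: "col ?\<gamma> w = (if w = t \<or> w = s then a else if w \<le> t + r then b else c)"
      if "t \<le> w" "w < t + m" for w
      using col_upd[of t w s "hub a b c t" a] col_hub[OF that, of a b c] that s m_bounds r5 by auto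
    have rng: "hub a b c t \<in> V \<rightarrow>\<^sub>E {1..3}"
      using interval_coloring_range[OF abc] unfolding hub_def .
    have lift: "z = w mod m \<Longrightarrow> f z = col f w" for z w and f :: "int \<Rightarrow> nat"
      unfolding col_def by simp
    have "acyclic (mono_arcs {x \<in> V. ?\<gamma> x = i})" if i: "i \<in> {a, b, c}" for i
    proof -
      consider "i = a" | "i = b" | "i = c" using i by blast
      then show ?thesis
      proof cases
        case 1
        show ?thesis
        proof (rule acyclic_pair)
          fix z assume z: "z \<in> V" "?\<gamma> z = i"
          obtain w where w: "t \<le> w" "w < t + m" "w mod m = z mod m"
            using residue_window[OF m_pos] by blast
          have zw: "z = w mod m" using z(1) w(3) unfolding V_def by simp
          then have "w = t \<or> w = s"
            using z(2) \<gamma>[OF w(1,2)] lift[OF zw, of ?\<gamma>] ne 1 by (auto split: if_splits)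
          then show "z = t mod m \<or> z = s mod m" using zw by blast
        qed (rule mod_in_V)+
      next
        case 2
        have "fits ?\<gamma> b (t + 1) 0"
          unfolding fits_def
        proof (intro allI impI, elim conjE)
          fix w assume w: "t + 1 \<le> w" "w < t + 1 + m" "col ?\<gamma> w = b"
          have "w \<noteq> t + m" using w(3) \<gamma>[of t] ne m_pos col_shift(1)[of ?\<gamma> t] by auto
          then have "w \<le> t + r" using w \<gamma>[of w] ne by (auto split: if_splits)
          then show "w < t + 1 + r + 2 * 0 \<and> (0 = (1::int) \<longrightarrow> w \<noteq> t + 1 + 1
            \<and> w \<noteq> t + 1 + r)"
            by simp
        qed
        then show ?thesis using acyclic_fits 2 by blast
      next
        case 3
        have "fits ?\<gamma> c (t + r + 1) 0"
          unfolding fits_def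
        proof (intro allI impI, elim conjE)
          fix w assume w: "t + r + 1 \<le> w" "w < t + r + 1 + m" "col ?\<gamma> w = c"
          have "w < t + m"
          proof (rule ccontr)
            assume "\<not> ?thesis"
            then show False
              using w \<gamma>[of "w - m"] ne m_bounds r5 by (auto split: if_splits)
          qed
          then show "w < t + r + 1 + r + 2 * 0 \<and> (0 = (1::int) \<longrightarrow> w \<noteq> t + r
            + 1 + 1 \<and> w \<noteq> t + r + 1 + r)"
            using m_bounds by simp
        qed
        then show ?thesis using acyclic_fits 3 by blast
      qed
    qed
    then have valid: "?\<gamma> \<in> colorings"
      unfolding colorings_iff using upd_in[OF rng ne(4)] abc by blast
    have "close ?\<gamma> (hub a c b s) 1"
    proof (rule close_one[OF valid hub_valid[OF acb]])
      fix z assume z: "z \<in> V" "z \<noteq> t mod m"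
      obtain w where w: "t \<le> w" "w < t + m" "w mod m = z mod m"
        using residue_window[OF m_pos] by blast
      have zw: "z = w mod m" using z(1) w(3) unfolding V_def by simp
      have wt: "w \<noteq> t" using z(2) zw by blast
      have "col ?\<gamma> w = col (hub a c b s) w"
      proof (cases "s \<le> w")
        case True
        then show ?thesis
          using \<gamma>[OF w(1,2)] col_hub[of s w a c b] w s wt m_bounds by auto
      next
        case False
        then show ?thesis
          using \<gamma>[OF w(1,2)] col_hub[of s "w + m" a c b] w s wt m_bounds by auto
      qed
      then show "?\<gamma> z = hub a c b s z" using lift[OF zw] by metis
    qed
    from within_dist_trans[OF close_upd[OF hub_valid[OF abc] valid] this]
    show ?thesis by simp
  qed
  show "close (hub a b c t) (hub a c b (t + r)) 2" "close (hub a b c t) (hub a c b (t + r + 1)) 2"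
    by (rule swap, simp)+
qed

text \<open>Erasing \<open>a\<close> from its two overlaps leaves \<open>u + v + 1\<close> vertices,
  which are reduced to the first or to the last one. The remaining boundary is sharpened where the
  resulting hub needs it: at \<open>z\<close>, for cost \<open>u\<close>, with the hub at
  \<open>z - r - 1\<close>; at \<open>y + r\<close>, for cost \<open>v\<close>, with the hub at
  \<open>y - 1\<close>.\<close>

lemma source_hub:
  assumes f: "contained \<alpha> a b c x y z"
  obtains t u v where "0 \<le> u" "0 \<le> v" "u + v + 1 \<le> int (card {s \<in> V. \<alpha> s = a})"
    "close \<alpha> (hub a b c t) (int (card {s \<in> V. \<alpha> s = a}) - 1 + u)"
    "close \<alpha> (hub a b c (t + u + v)) (int (card {s \<in> V. \<alpha> s = a}) - 1 + v)"
proof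
  have t: "short_gaps x y z" and abc: "{a, b, c} = {1..3}" using f unfolding contained_def by auto
  note ne = triple_eq[OF abc]
  let ?l = "int (card {s \<in> V. \<alpha> s = a})"
  define u v where "u = count \<alpha> b z (y + r)" and "v = count \<alpha> c z (y + r)"
  define k1 k2 where "k1 = count \<alpha> a x (z + r - m)" and "k2 = count \<alpha> a y (x + r)"
  have uv: "u + v = y + r - z"
    unfolding u_def v_def
  proof (rule count_two)
    show "z \<le> y + r" using t unfolding short_gaps_def by simp
    show "col \<alpha> w = b \<or> col \<alpha> w = c" if "z \<le> w" "w < y + r" for w
      using contained_zone(1)[OF contained_rotate[OF f]] that by simp
  qed (rule ne)
  have le: "x \<le> z + r - m" "z + r - m \<le> y" "y \<le> x + r" "z + r - m \<le> x + r"
    using t m_bounds unfolding short_gaps_def by linarith+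
  have "count \<alpha> a (z + r - m) y = y - (z + r - m)"
    using count_all[OF le(2), of \<alpha> a] contained_zone(2)[OF f] by blast
  then have cnt: "count \<alpha> a x (x + r) = k1 + k2 + (u + v) + 1"
    using count_split[OF le(1,4), of \<alpha> a] count_split[OF le(2,3), of \<alpha> a] m
    unfolding k1_def k2_def uv by linarith
  have "inj_on (\<lambda>w. w mod m) {w \<in> {x..<x + r}. col \<alpha> w = a}"
    using mod_eq_window[of x] m_bounds r5 by (auto simp: inj_on_def)
  then have "card {w \<in> {x..<x + r}. col \<alpha> w = a}
    = card ((\<lambda>w. w mod m) ` {w \<in> {x..<x + r}. col \<alpha> w = a})"
    by (simp add: card_image)
  also have "\<dots> \<le> card {s \<in> V. \<alpha> s = a}"
    by (rule card_mono) (auto simp: finite_V mod_in_V col_def)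
  finally have l: "k1 + k2 + (u + v) + 1 \<le> ?l"
    unfolding cnt[symmetric] unfolding count_def by simp
  show "0 \<le> u" "0 \<le> v" unfolding u_def v_def by (rule count_nonneg)+
  have "0 \<le> k1" "0 \<le> k2" unfolding k1_def k2_def by (rule count_nonneg)+
  then show "u + v + 1 \<le> ?l" using l by simp
  have m': "z + r - m = z - r - 1" using m by simp
  show "close \<alpha> (hub a b c (z - r - 1)) (?l - 1 + u)"
    using close_hub[OF f, of "z + r - m" k1 y k2 z u "z - r - 1"] l t uv unfolding m'
    by (auto simp: k1_def k2_def u_def m' short_gaps_def elim!: within_dist_mono)
  have "close \<alpha> (hub a b c (y - 1)) (?l - 1 + v)"
    using close_hub[OF f, of "z + r - m" k1 y k2 "y + r" v "y - 1"] l t uv unfolding m'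
    by (auto simp: k1_def k2_def v_def m' short_gaps_def elim!: within_dist_mono)
  moreover have "z - r - 1 + u + v = y - 1" using uv by simp
  ultimately show "close \<alpha> (hub a b c (z - r - 1 + u + v)) (?l - 1 + v)" by (simp only:)
qed

text \<open>A flag \<open>1\<close> marks a class whose first and last vertices \<open>x\<close> and \<open>x + r + 1\<close> are too far apart
  for a window. It is repaired by giving its last vertex to the next class, or its first
  vertex to the previous one.\<close>

definition gap_ok :: "int \<Rightarrow> int \<Rightarrow> int \<Rightarrow> bool" where
  "gap_ok e f d \<longleftrightarrow> d + 2 * f \<le> r \<and> 2 * e \<le> d"

text \<open>With flag 1 both extreme vertices must really have colour \<open>i\<close>; this makes
  each repair change the counts by exactly 1.\<close>

definition ends :: "(int \<Rightarrow> nat) \<Rightarrow> nat \<Rightarrow> int \<Rightarrow> int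
  \<Rightarrow> bool" where
  "ends \<alpha> i x e \<longleftrightarrow> (e = 0 \<or> e = 1) \<and> fits \<alpha> i x e \<and> (e = 1
    \<longrightarrow> col \<alpha> x = i \<and> col \<alpha> (x + r + 1) = i)"

text \<open>The inequalities in \<open>gap_ok\<close> keep repairs legal: for \<open>e = 1\<close>
  the vertex \<open>x + r + 1\<close> lies in the window of \<open>b\<close> and, if
  \<open>f = 1\<close>, misses the holes \<open>y + 1\<close> and \<open>y + r\<close>.
  Symmetrically, for \<open>f = 1\<close> the vertex \<open>y\<close> fits into the window of
  \<open>a\<close>.\<close>

definition repairable ::
  "(int \<Rightarrow> nat) \<Rightarrow> nat \<Rightarrow> nat \<Rightarrow> nat \<Rightarrow> int
    \<Rightarrow> int \<Rightarrow> int \<Rightarrow> int \<Rightarrow> int \<Rightarrow> int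
      \<Rightarrow> bool" where
  "repairable \<alpha> a b c x y z e f g \<longleftrightarrow> \<alpha> \<in> V \<rightarrow>\<^sub>E
    {1..3} \<and> {a, b, c} = {1..3} \<and>
     gap_ok e f (y - x) \<and> gap_ok f g (z - y) \<and> gap_ok g e (x + m - z) \<and>
     ends \<alpha> a x e \<and> ends \<alpha> b y f \<and> ends \<alpha> c z g"

lemma ends_shift: "ends \<alpha> i (x + m) e \<longleftrightarrow> ends \<alpha> i x e"
proof -
  have eq: "x + m + r + 1 = (x + r + 1) + m" by simp
  show ?thesis
    unfolding ends_def eq using fits_shift[of \<alpha> i x 1 e] by simp
qed

lemma repairable_rotate:
  "repairable \<alpha> a b c x y z e f g \<Longrightarrow> repairable \<alpha> b c a y z (x + m) f g e"
  unfolding repairable_def ends_shift by (auto simp: insert_commute)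

lemma repairable_coloring: "repairable \<alpha> a b c x y z e f g \<Longrightarrow> \<alpha> \<in> colorings"
  unfolding repairable_def ends_def using coloringI[of \<alpha> a b c x e y f z g] by simp

lemma repairable_contained:
  "repairable \<alpha> a b c x y z 0 0 0 \<longleftrightarrow> contained \<alpha> a b c x y z"
  unfolding repairable_def contained_def ends_def gap_ok_def short_gaps_def using m_bounds r5 by auto

text \<open>The cost of reaching a colouring from the intervals that start at \<open>x\<close>, \<open>y\<close>, \<open>z\<close>, respectively
  from those that start where the windows of the previous classes end, repairs included.\<close>

definition left_count ::
  "(int \<Rightarrow> nat) \<Rightarrow> nat \<Rightarrow> nat \<Rightarrow> nat \<Rightarrow> int
    \<Rightarrow> int \<Rightarrow> int \<Rightarrow> int \<Rightarrow> int \<Rightarrow> int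
      \<Rightarrow> int" where
  "left_count \<alpha> a b c x y z e f g =
     count \<alpha> c x (z + r - m + 2 * g) + count \<alpha> a y (x + r + 2 * e) + count \<alpha> b z (y
       + r + 2 * f)"

definition right_count ::
  "(int \<Rightarrow> nat) \<Rightarrow> nat \<Rightarrow> nat \<Rightarrow> nat \<Rightarrow> int
    \<Rightarrow> int \<Rightarrow> int \<Rightarrow> int \<Rightarrow> int \<Rightarrow> int
      \<Rightarrow> int" where
  "right_count \<alpha> a b c x y z e f g =
     count \<alpha> a x (z + r - m + 2 * g) + count \<alpha> b y (x + r + 2 * e) + count \<alpha> c z (y
       + r + 2 * f)"

lemma count_shift: "count \<alpha> i (x + m) (y + m) = count \<alpha> i x y"
proof -
  have "{w \<in> {x + m..<y + m}. col \<alpha> w = i} = (\<lambda>w. w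
    + m) ` {w \<in> {x..<y}. col \<alpha> w = i}"
  proof (intro set_eqI iffI)
    fix w assume "w \<in> {w \<in> {x + m..<y + m}. col \<alpha> w = i}"
    then have "w - m \<in> {w \<in> {x..<y}. col \<alpha> w = i}" by auto
    then show "w \<in> (\<lambda>w. w + m) ` {w \<in> {x..<y}. col \<alpha> w = i}"
      by (rule rev_image_eqI) simp
  qed auto
  then show ?thesis unfolding count_def by (simp add: card_image)
qed

lemma left_count_rotate: "left_count \<alpha> b c a y z (x + m) f g e = left_count \<alpha> a b c x y z e f g"
  unfolding left_count_def
  using count_shift[of \<alpha> c x "z + r - m + 2 * g"] by (simp add: algebra_simps)

lemma right_count_rotate:
  "right_count \<alpha> b c a y z (x + m) f g e = right_count \<alpha> a b c x y z e f g"
  unfolding right_count_def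
  using count_shift[of \<alpha> a x "z + r - m + 2 * g"] by (simp add: algebra_simps)

lemma count_cong: "(\<And>w. x \<le> w \<Longrightarrow> w < y \<Longrightarrow> col \<alpha> w
  = col \<beta> w) \<Longrightarrow> count \<alpha> i x y = count \<beta> i x y"
  unfolding count_def by (metis (mono_tags, lifting) atLeastLessThan_iff)

lemma count_single: "count \<alpha> i x (x + 1) = (if col \<alpha> x = i then 1 else 0)"
proof -
  have "{w \<in> {x..<x + 1}. col \<alpha> w = i} = (if col \<alpha> x = i then {x} else {})" by auto
  then show ?thesis unfolding count_def by simp
qed

lemma count_pair:
  "count \<alpha> i x (x + 2) = (if col \<alpha> x = i then 1 else 0) + (if col \<alpha> (x + 1)
    = i then 1 else 0)"
  using count_split[of x "x + 1" "x + 2" \<alpha> i] count_single[of \<alpha> i x]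
  count_single[of \<alpha> i "x + 1"]
  by (simp add: add.assoc)

end

section \<open>Repairing gapped classes\<close>

context circulant
begin

lemma repairable_shift:
  "repairable \<alpha> a b c (x + m) (y + m) (z
    + m) e f g \<longleftrightarrow> repairable \<alpha> a b c x y z e f g"
proof -
  have "x + m + m - (z + m) = x + m - z" "y + m - (x + m) = y - x" "z + m - (y + m) = z - y"
    by simp_all
  then show ?thesis unfolding repairable_def ends_shift by (simp only:)
qed

text \<open>The vertex \<open>x + r + 1\<close> goes to the next class. The start \<open>x\<close>
  stays, and the window loses the positions \<open>x + r\<close>, which is a hole, and
  \<open>x + r + 1\<close>. Hence exactly one vertex disappears from the count of
  \<open>a\<close>.\<close>

lemma give_last:
  assumes \<alpha>: "repairable \<alpha> a b c x y z e f g"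
  obtains \<beta> where "repairable \<beta> a b c x y z 0 f g" "close \<alpha> \<beta> e"
    "left_count \<beta> a b c x y z 0 f g = left_count \<alpha> a b c x y z e f g - e"
proof -
  have gp: "gap_ok e f (y - x)" "gap_ok f g (z - y)" "gap_ok g e (x + m - z)"
    and en: "ends \<alpha> a x e" "ends \<alpha> b y f" "ends \<alpha> c z g"
    and rng: "\<alpha> \<in> V \<rightarrow>\<^sub>E {1..3}" and abc: "{a, b, c} = {1..3}"
    using \<alpha> unfolding repairable_def by auto
  note ne = triple_eq[OF abc]
  show ?thesis
  proof (cases "e = 0")
    case True
    then show ?thesis using that[of \<alpha>] \<alpha> close_refl repairable_coloring by simp
  next
    case False
    then have e: "e = 1" using en unfolding ends_def by auto
    have fl: "f = 0 \<or> f = 1" "g = 0 \<or> g = 1" using en unfolding ends_def by auto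
    note gaps = gp[unfolded gap_ok_def]
    have ord: "x < y" "y < z" "z < x + m" using gaps fl e m_bounds by auto
    have ca: "col \<alpha> x = a" "col \<alpha> (x + r + 1) = a" using en(1) e unfolding ends_def by auto
    define \<beta> where "\<beta> = \<alpha>((x + r + 1) mod m := b)"
    have col: "col \<beta> w = (if w = x + r + 1 then b else col \<alpha> w)" if "x < w" "w \<le> x + m" for w
      unfolding \<beta>_def using col_upd[of "x + 1" w "x + r + 1" \<alpha> b] that m_bounds r5 by simp
    have col_x: "col \<beta> x = col \<alpha> x" using col[of "x + m"] m_bounds r5 by simp
    have "fits \<beta> a x 0"
      unfolding fits_def
    proof (intro allI impI, elim conjE)
      fix w assume w: "x \<le> w" "w < x + m" "col \<beta> w = a"
      have "w = x \<or> w \<noteq> x + r + 1 \<and> col \<alpha> w = a" using w col[of w] ne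
        by (auto split: if_splits)
      moreover have "fits \<alpha> a x 1" using en(1) e unfolding ends_def by simp
      ultimately have "w < x + r" using fitsD[of \<alpha> a x 1 w] w r5 by auto
      then show "w < x + r + 2 * 0 \<and> (0 = (1::int) \<longrightarrow> w \<noteq> x + 1
        \<and> w \<noteq> x + r)" by simp
    qed
    then have "ends \<beta> a x 0" unfolding ends_def by simp
    moreover have "ends \<beta> b y f"
    proof -
      have fit: "fits \<alpha> b y f" and cb:
        "f = 1 \<longrightarrow> col \<alpha> y = b \<and> col \<alpha> (y + r + 1) = b"
        using en(2) unfolding ends_def by auto
      have "fits \<beta> b y f"
        unfolding fits_def
      proof (intro allI impI, elim conjE)
        fix w assume w: "y \<le> w" "w < y + m" "col \<beta> w = b"
        show "w < y + r + 2 * f \<and> (f = 1 \<longrightarrow> w \<noteq> y + 1 \<and> w \<noteq> y + r)"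
        proof (cases "w = x + r + 1")
          case True
          then show ?thesis using gaps e fl m_bounds by auto
        next
          case False
          have "col \<alpha> w = b"
          proof (cases "w \<le> x + m")
            case True
            then show ?thesis using col[of w] w False gaps m_bounds fl e ord by auto
          next
            case f: False
            have "w - m \<noteq> x + r + 1" using w gaps m_bounds fl e ord by auto
            then show ?thesis using col[of "w - m"] w f gaps m_bounds fl ord by auto
          qed
          then show ?thesis using fitsD[OF fit w(1,2)] by simp
        qed
      qed
      moreover have "f = 1 \<longrightarrow> col \<beta> y = b \<and> col \<beta> (y + r + 1) = b"
      proof
        assume f: "f = 1"
        then have "col \<beta> y = b" using col[of y] cb gaps m_bounds fl ord by auto
        moreover have "col \<beta> (y + r + 1) = b"
          using col[of "y + r + 1"] cb f gaps m_bounds fl ord by auto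
        ultimately show "col \<beta> y = b \<and> col \<beta> (y + r + 1) = b" by blast
      qed
      ultimately show ?thesis using fl unfolding ends_def by blast
    qed
    moreover have "ends \<beta> c z g"
    proof -
      have fit: "fits \<alpha> c z g" and cc:
        "g = 1 \<longrightarrow> col \<alpha> z = c \<and> col \<alpha> (z + r + 1) = c"
        using en(3) unfolding ends_def by auto
      have eq: "col \<beta> w = col \<alpha> w" if "col \<alpha> w \<noteq> a" for w
      proof (cases "w mod m = (x + r + 1) mod m")
        case True
        then show ?thesis using that ca(2) col_cong by metis
      next
        case False
        then show ?thesis unfolding \<beta>_def by (simp add: col_upd_mod)
      qed
      have "col \<beta> w = c \<Longrightarrow> col \<alpha> w = c" for w
        using ne unfolding \<beta>_def by (auto simp: col_upd_mod split: if_splits)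
      then have "fits \<beta> c z g" using fit unfolding fits_def by blast
      then show ?thesis using eq cc fl ne unfolding ends_def by auto
    qed
    moreover have "gap_ok 0 f (y - x)" "gap_ok g 0 (x + m - z)"
      using gp fl m_bounds e unfolding gap_ok_def by auto
    moreover have "\<beta> \<in> V \<rightarrow>\<^sub>E {1..3}" unfolding \<beta>_def
      using upd_in[OF rng] ne by blast
    ultimately have \<beta>: "repairable \<beta> a b c x y z 0 f g"
      unfolding repairable_def using gp(2) abc by blast
    have 1: "count \<beta> c x (z + r - m + 2 * g) = count \<alpha> c x (z + r - m + 2 * g)"
    proof (rule count_cong)
      fix w assume w: "x \<le> w" "w < z + r - m + 2 * g"
      then show "col \<beta> w = col \<alpha> w" using col[of w] col_x gaps e ord m_bounds r5 fl
        by (cases "w = x") auto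
    qed
    have 2: "count \<beta> b z (y + r + 2 * f) = count \<alpha> b z (y + r + 2 * f)"
    proof (rule count_cong)
      fix w assume w: "z \<le> w" "w < y + r + 2 * f"
      then show "col \<beta> w = col \<alpha> w" using col[of w] gaps e m_bounds fl ord by auto
    qed
    have "col \<alpha> (x + r) \<noteq> a"
      using en(1) e m_bounds r5 fitsD(3)[of \<alpha> a x 1 "x + r"] unfolding ends_def by auto
    then have "count \<alpha> a (x + r) (x + r + 2) = 1" using ca count_pair[of \<alpha> a "x + r"] by simp
    moreover have "count \<beta> a y (x + r) = count \<alpha> a y (x + r)"
    proof (rule count_cong)
      fix w assume w: "y \<le> w" "w < x + r"
      then show "col \<beta> w = col \<alpha> w" using col[of w] gaps e m_bounds fl ord by auto
    qed
    moreover have "y \<le> x + r" using gaps fl by auto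
    ultimately have 3: "count \<beta> a y (x + r) = count \<alpha> a y (x + r + 2) - 1"
      using count_split[of y "x + r" "x + r + 2" \<alpha> a] by simp
    have "left_count \<beta> a b c x y z 0 f g = left_count \<alpha> a b c x y z e f g - e"
      unfolding left_count_def using 1 2 3 e by simp
    moreover have "close \<alpha> \<beta> e"
      using close_upd[of \<alpha> "x + r + 1" b] repairable_coloring[OF \<alpha>]
      repairable_coloring[OF \<beta>] e unfolding \<beta>_def by simp
    ultimately show ?thesis using that \<beta> by blast
  qed
qed

text \<open>Mirror image of \<open>give_last\<close>: the vertex \<open>x\<close> goes to the
  previous class. As \<open>x + 1\<close> is a hole, the start moves by two, and the remaining
  window \<open>x + 2..<x + r + 2\<close> again has length \<open>r\<close>.\<close>

lemma give_first:
  assumes \<alpha>: "repairable \<alpha> a b c x y z e f g"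
  obtains \<beta> where "repairable \<beta> a b c (x + 2 * e) y z 0 f g" "close \<alpha> \<beta> e"
    "right_count \<beta> a b c (x + 2 * e) y z 0 f g = right_count \<alpha> a b c x y z e f g - e"
proof -
  have gp: "gap_ok e f (y - x)" "gap_ok f g (z - y)" "gap_ok g e (x + m - z)"
    and en: "ends \<alpha> a x e" "ends \<alpha> b y f" "ends \<alpha> c z g"
    and rng: "\<alpha> \<in> V \<rightarrow>\<^sub>E {1..3}" and abc: "{a, b, c} = {1..3}"
    using \<alpha> unfolding repairable_def by auto
  note ne = triple_eq[OF abc]
  show ?thesis
  proof (cases "e = 0")
    case True
    then show ?thesis using that[of \<alpha>] \<alpha> close_refl repairable_coloring by simp
  next
    case False
    then have e: "e = 1" using en unfolding ends_def by auto
    have fl: "f = 0 \<or> f = 1" "g = 0 \<or> g = 1" using en unfolding ends_def by auto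
    note gaps = gp[unfolded gap_ok_def]
    have ord: "x < y" "y < z" "z < x + m" using gaps fl e m_bounds by auto
    have ca: "col \<alpha> x = a" "col \<alpha> (x + r + 1) = a" using en(1) e unfolding ends_def by auto
    define \<beta> where "\<beta> = \<alpha>(x mod m := c)"
    have col: "col \<beta> w = (if w = x then c else col \<alpha> w)" if "x \<le> w" "w < x + m" for w
      unfolding \<beta>_def using col_upd[of x w x \<alpha> c] that m_bounds r5 by simp
    have col_m: "col \<beta> (x + m) = c" using col[of x] m_bounds r5 by simp
    have "fits \<beta> a (x + 2) 0"
      unfolding fits_def
    proof (intro allI impI, elim conjE)
      fix w assume w: "x + 2 \<le> w" "w < x + 2 + m" "col \<beta> w = a"
      have fit: "fits \<alpha> a x 1" using en(1) e unfolding ends_def by simp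
      have "w < x + m"
      proof (rule ccontr)
        assume "\<not> ?thesis"
        then have "w - m = x \<or> w - m = x + 1" using w by auto
        moreover have wm: "col \<beta> (w - m) = a" and "1 < m" using w(3) m_bounds(1) r5 by simp_all
        moreover have "w - m \<noteq> x"
        proof
          assume "w - m = x"
          with wm have "col \<beta> x = a" by (simp only:)
          then show False using col[of x] m_pos ne by simp
        qed
        ultimately have "col \<beta> (x + 1) = a" by metis
        then have "col \<alpha> (x + 1) = a" using col[of "x + 1"] \<open>1 < m\<close> by simp
        then show False using fitsD(2)[OF fit, of "x + 1"] m_bounds r5 by auto
      qed
      then have "col \<alpha> w = a" using w col[of w] by simp
      then show "w < x + 2 + r + 2 * 0 \<and> (0 = (1::int) \<longrightarrow> w \<noteq> x + 2 + 1
        \<and> w \<noteq> x + 2 + r)"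
        using fitsD(1)[OF fit, of w] w \<open>w < x + m\<close> by simp
    qed
    then have "ends \<beta> a (x + 2) 0" unfolding ends_def by simp
    moreover have "ends \<beta> c z g"
    proof -
      have fit: "fits \<alpha> c z g" and cc:
        "g = 1 \<longrightarrow> col \<alpha> z = c \<and> col \<alpha> (z + r + 1) = c"
        using en(3) unfolding ends_def by auto
      have "fits \<beta> c z g"
        unfolding fits_def
      proof (intro allI impI, elim conjE)
        fix w assume w: "z \<le> w" "w < z + m" "col \<beta> w = c"
        show "w < z + r + 2 * g \<and> (g = 1 \<longrightarrow> w \<noteq> z + 1 \<and> w \<noteq> z + r)"
        proof (cases "w = x + m")
          case True
          then show ?thesis using gaps e fl m_bounds by auto
        next
          case False
          have "col \<alpha> w = c"
          proof (cases "w < x + m")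
            case True
            then show ?thesis using col[of w] w False gaps m_bounds fl ord by auto
          next
            case f: False
            then show ?thesis using col[of "w - m"] w False gaps m_bounds fl ord by auto
          qed
          then show ?thesis using fitsD[OF fit w(1,2)] by simp
        qed
      qed
      moreover have "g = 1 \<longrightarrow> col \<beta> z = c \<and> col \<beta> (z + r + 1) = c"
        using cc unfolding \<beta>_def by (simp add: col_upd_mod)
      ultimately show ?thesis using fl unfolding ends_def by blast
    qed
    moreover have "ends \<beta> b y f"
    proof -
      have fit: "fits \<alpha> b y f" and cb:
        "f = 1 \<longrightarrow> col \<alpha> y = b \<and> col \<alpha> (y + r + 1) = b"
        using en(2) unfolding ends_def by auto
      have eq: "col \<beta> w = col \<alpha> w" if "col \<alpha> w \<noteq> a" for w
      proof (cases "w mod m = x mod m")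
        case True
        then show ?thesis using that ca(1) col_cong by metis
      next
        case False
        then show ?thesis unfolding \<beta>_def by (simp add: col_upd_mod)
      qed
      have "col \<beta> w = b \<Longrightarrow> col \<alpha> w = b" for w
        using ne unfolding \<beta>_def by (auto simp: col_upd_mod split: if_splits)
      then have "fits \<beta> b y f" using fit unfolding fits_def by blast
      then show ?thesis using eq cb fl ne unfolding ends_def by auto
    qed
    moreover have "gap_ok 0 f (y - (x + 2))" "gap_ok g 0 (x + 2 + m - z)"
      using gp fl m_bounds e unfolding gap_ok_def by auto
    moreover have "\<beta> \<in> V \<rightarrow>\<^sub>E {1..3}" unfolding \<beta>_def
      using upd_in[OF rng] ne by blast
    ultimately have \<beta>: "repairable \<beta> a b c (x + 2) y z 0 f g"
      unfolding repairable_def using gp(2) abc by blast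
    have 1: "count \<beta> b y (x + r + 2) = count \<alpha> b y (x + r + 2)"
    proof (rule count_cong)
      fix w assume w: "y \<le> w" "w < x + r + 2"
      then show "col \<beta> w = col \<alpha> w" using col[of w] gaps e m_bounds fl r5 by auto
    qed
    have 2: "count \<beta> c z (y + r + 2 * f) = count \<alpha> c z (y + r + 2 * f)"
    proof (rule count_cong)
      fix w assume w: "z \<le> w" "w < y + r + 2 * f"
      then show "col \<beta> w = col \<alpha> w" using col[of w] gaps e m_bounds fl ord by auto
    qed
    have "col \<alpha> (x + 1) \<noteq> a"
      using en(1) e m_bounds r5 fitsD(2)[of \<alpha> a x 1 "x + 1"] unfolding ends_def by auto
    then have "count \<alpha> a x (x + 2) = 1" using ca count_pair[of \<alpha> a x] by simp
    moreover have "count \<beta> a (x + 2) (z + r - m + 2 * g) = count \<alpha> a (x + 2) (z + r - m + 2 * g)"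
    proof (rule count_cong)
      fix w assume w: "x + 2 \<le> w" "w < z + r - m + 2 * g"
      then show "col \<beta> w = col \<alpha> w" using col[of w] gaps e m_bounds fl ord by auto
    qed
    moreover have "x + 2 \<le> z + r - m + 2 * g" using gaps fl e m_bounds by auto
    ultimately have 3: "count \<beta> a (x + 2) (z + r - m + 2 * g) = count \<alpha> a x (z + r - m
      + 2 * g) - 1"
      using count_split[of x "x + 2" "z + r - m + 2 * g" \<alpha> a] by simp
    have "right_count \<beta> a b c (x + 2) y z 0 f g = right_count \<alpha> a b c x y z e f g - e"
      unfolding right_count_def using 1 2 3 e by (simp add: algebra_simps)
    moreover have "close \<alpha> \<beta> e"
      using close_upd[of \<alpha> x c] repairable_coloring[OF \<alpha>] repairable_coloring[OF \<beta>] e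
      unfolding \<beta>_def by simp
    ultimately show ?thesis using that[of \<beta>] \<beta> e by simp
  qed
qed

text \<open>Each repair acts on the first class, and rotating the roles brings the next class to the
  front; three rotations shift all positions by \<open>m\<close>.\<close>

lemma give_last_all:
  assumes "repairable \<alpha> a b c x y z e f g"
  obtains \<beta> where "contained \<beta> a b c x y z" "close \<alpha> \<beta> (e + f + g)"
    "left_count \<beta> a b c x y z 0 0 0 = left_count \<alpha> a b c x y z e f g - (e + f + g)"
proof -
  obtain \<beta>1 where 1: "repairable \<beta>1 a b c x y z 0 f g" "close \<alpha> \<beta>1 e"
    "left_count \<beta>1 a b c x y z 0 f g = left_count \<alpha> a b c x y z e f g - e"
    using give_last[OF assms] .
  obtain \<beta>2 where 2: "repairable \<beta>2 b c a y z (x + m) 0 g 0" "close \<beta>1 \<beta>2 f"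
    "left_count \<beta>2 b c a y z (x + m) 0 g 0 = left_count \<beta>1 b c a y z (x + m) f g 0 - f"
    using give_last[OF repairable_rotate[OF 1(1)]] .
  obtain \<beta>3 where 3: "repairable \<beta>3 c a b z (x + m) (y + m) 0 0 0" "close \<beta>2 \<beta>3 g"
    "left_count \<beta>3 c a b z (x + m) (y + m) 0 0 0 = left_count \<beta>2 c a b z (x + m) (y
      + m) g 0 0 - g"
    using give_last[OF repairable_rotate[OF 2(1)]] .
  have g: "repairable \<beta>3 a b c x y z 0 0 0"
    using repairable_rotate[OF 3(1)] unfolding repairable_shift .
  have "left_count \<beta>3 a b c x y z 0 0 0 = left_count \<alpha> a b c x y z e f g - (e + f + g)"
    using 1(3) 2(3) 3(3) by (simp add: left_count_rotate)
  moreover have "close \<alpha> \<beta>3 (e + f + g)"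
    using within_dist_trans[OF within_dist_trans[OF 1(2) 2(2)] 3(2)] .
  ultimately show ?thesis using that g repairable_contained by blast
qed

lemma give_first_all:
  assumes "repairable \<alpha> a b c x y z e f g"
  obtains \<beta> where "contained \<beta> a b c (x + 2 * e) (y + 2 * f) (z + 2 * g)"
    "close \<alpha> \<beta> (e + f + g)"
    "right_count \<beta> a b c (x + 2 * e) (y + 2 * f) (z + 2 * g) 0 0 0
      = right_count \<alpha> a b c x y z e f g - (e + f + g)"
proof -
  let ?x = "x + 2 * e" and ?y = "y + 2 * f" and ?z = "z + 2 * g"
  obtain \<beta>1 where 1: "repairable \<beta>1 a b c ?x y z 0 f g" "close \<alpha> \<beta>1 e"
    "right_count \<beta>1 a b c ?x y z 0 f g = right_count \<alpha> a b c x y z e f g - e"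
    using give_first[OF assms] .
  obtain \<beta>2 where 2: "repairable \<beta>2 b c a ?y z (?x + m) 0 g 0" "close \<beta>1 \<beta>2 f"
    "right_count \<beta>2 b c a ?y z (?x + m) 0 g 0 = right_count \<beta>1 b c a y z (?x + m) f g 0 - f"
    using give_first[OF repairable_rotate[OF 1(1)]] .
  obtain \<beta>3 where 3: "repairable \<beta>3 c a b ?z (?x + m) (?y + m) 0 0 0" "close \<beta>2 \<beta>3 g"
    "right_count \<beta>3 c a b ?z (?x + m) (?y + m) 0 0 0 = right_count \<beta>2 c a b z (?x + m) (?y
      + m) g 0 0 - g"
    using give_first[OF repairable_rotate[OF 2(1)]] .
  have g: "repairable \<beta>3 a b c ?x ?y ?z 0 0 0"
    using repairable_rotate[OF 3(1)] unfolding repairable_shift .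
  have "right_count \<beta>3 a b c ?x ?y ?z 0 0 0 = right_count \<alpha> a b c x y z e f g - (e + f + g)"
    using 1(3) 2(3) 3(3) by (simp add: right_count_rotate)
  moreover have "close \<alpha> \<beta>3 (e + f + g)"
    using within_dist_trans[OF within_dist_trans[OF 1(2) 2(2)] 3(2)] .
  ultimately show ?thesis using that g repairable_contained by blast
qed

text \<open>Each extended overlap contains only its two colours, one counted on the left and one on
  the right. Together the overlaps have \<open>3 * r - m + 2 * (e + f + g)\<close> vertices.\<close>

lemma left_right_count:
  assumes \<alpha>: "repairable \<alpha> a b c x y z e f g"
  shows "left_count \<alpha> a b c x y z e f g + right_count \<alpha> a b c x y z e f g = r - 1 + 2 * (e
    + f + g)"
proof -
  have zone: "count \<alpha> a y (x + r + 2 * e) + count \<alpha> b y (x + r + 2 * e) = x + r + 2 * e - y"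
    if \<alpha>: "repairable \<alpha> a b c x y z e f g" for a b c x y z e f g
  proof (rule count_two)
    have gp: "gap_ok e f (y - x)" "gap_ok f g (z - y)" "gap_ok g e (x + m - z)"
      and en: "ends \<alpha> a x e" "ends \<alpha> b y f" "ends \<alpha> c z g"
      and rng: "\<alpha> \<in> V \<rightarrow>\<^sub>E {1..3}" and abc: "{a, b, c} = {1..3}"
      using \<alpha> unfolding repairable_def by auto
    note ne = triple_eq[OF abc]
    note gaps = gp[unfolded gap_ok_def]
    have fl: "e = 0 \<or> e = 1" "f = 0 \<or> f = 1" "g = 0 \<or> g = 1" using en unfolding ends_def by auto
    show "y \<le> x + r + 2 * e" using gaps fl by auto
    show "a \<noteq> b" by (rule ne)
    fix w assume w: "y \<le> w" "w < x + r + 2 * e"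
    have "col \<alpha> w \<noteq> c"
    proof
      assume c: "col \<alpha> w = c"
      show False
      proof (cases "w < z")
        case True
        have "col \<alpha> (w + m) = c" using c by simp
        then have "w + m < z + r + 2 * g"
          using fitsD(1)[of \<alpha> c z g "w + m"] en(3) True w gaps m_bounds fl unfolding ends_def by auto
        then show False using w gaps m_bounds fl by auto
      next
        case False
        then have "w = x + r + 1" "e = 1" using w gaps m_bounds fl by auto
        then show False using c en(1) ne unfolding ends_def by auto
      qed
    qed
    then show "col \<alpha> w = a \<or> col \<alpha> w = b" using col_cases[OF rng abc] by blast
  qed
  note \<alpha>2 = repairable_rotate[OF \<alpha>]
  note \<alpha>3 = repairable_rotate[OF \<alpha>2]
  show ?thesis
    using zone[OF \<alpha>] zone[OF \<alpha>2] zone[OF \<alpha>3] m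
    count_shift[of \<alpha> a x "z + r - m + 2 * g"]
      count_shift[of \<alpha> c x "z + r - m + 2 * g"]
    unfolding left_count_def right_count_def by (simp add: algebra_simps)
qed

end

section \<open>Distance between colourings with a cyclic order\<close>

lemma triple_perm:
  assumes abc: "{a, b, c} = {1..3::nat}" and abc': "{a', b', c'} = {1..3}"
  obtains "a' = a" "b' = b" "c' = c" | "a' = b" "b' = c" "c' = a" | "a' = c" "b' = a" "c' = b"
    | "a' = a" "b' = c" "c' = b" | "a' = c" "b' = b" "c' = a" | "a' = b" "b' = a" "c' = c"
proof -
  have "a' \<in> {a, b, c}" "b' \<in> {a, b, c}" "c' \<in> {a, b, c}"
    unfolding abc abc'[symmetric] by auto
  moreover have "a' \<noteq> b'" "b' \<noteq> c'" "a' \<noteq> c'" by (rule triple_eq[OF abc'])+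
  ultimately show ?thesis using that by (elim insertE emptyE) simp_all
qed

context circulant
begin

text \<open>Measured from the boundaries \<open>x\<close>, \<open>x + 1\<close>,
  \<open>x + r + 1\<close> of the hub at \<open>x\<close>, the overlaps of the target occupy
  \<open>0..o1\<close>, then \<open>o1..o1 + o3\<close> for the third boundary and
  \<open>o1 + o3..r - 1\<close> for the second. The repair \<gamma> by last vertices provides the
  assumption \<open>up\<close> of \<open>rotating_hub_bound\<close>, the repair \<delta> by first
  vertices provides \<open>down\<close>.\<close>

lemma hub_to_repairable:
  assumes \<beta>: "repairable \<beta> a b c x y z e f g"
    and uv: "0 \<le> u" "0 \<le> v" "3 * (u + v + 1) \<le> m" "\<epsilon> = 0 \<or> \<epsilon> = 1"
  shows "close (hub a b c t) \<beta> (3 * r + 1 - \<epsilon> - u) \<or>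
    close (hub a b c (t + u + v + \<epsilon>)) \<beta> (3 * r + 1 - \<epsilon> - v)"
proof -
  obtain \<gamma> where \<gamma>: "contained \<gamma> a b c x y z" "close \<beta> \<gamma> (e + f + g)"
    and lc: "left_count \<gamma> a b c x y z 0 0 0 = left_count \<beta> a b c x y z e f g - (e + f + g)"
    using give_last_all[OF \<beta>] .
  obtain \<delta> where \<delta>: "contained \<delta> a b c (x + 2 * e) (y + 2 * f) (z + 2 * g)"
    "close \<beta> \<delta> (e + f + g)"
    and rc: "right_count \<delta> a b c (x + 2 * e) (y + 2 * f) (z + 2 * g) 0 0 0 =
      right_count \<beta> a b c x y z e f g - (e + f + g)"
    using give_first_all[OF \<beta>] .
  have gp: "gap_ok e f (y - x)" "gap_ok f g (z - y)" "gap_ok g e (x + m - z)"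
    and fl: "e = 0 \<or> e = 1" "f = 0 \<or> f = 1" "g = 0 \<or> g = 1"
    and abc: "{a, b, c} = {1..3}"
    using \<beta> unfolding repairable_def ends_def by auto
  note ne = triple_eq[OF abc]
  define u1 v1 where "u1 = count \<gamma> c x (z + r - m)" and "v1 = count \<gamma> a x (z + r - m)"
  define u2 v2 where "u2 = count \<gamma> a y (x + r)" and "v2 = count \<gamma> b y (x + r)"
  define u3 v3 where "u3 = count \<gamma> b z (y + r)" and "v3 = count \<gamma> c z (y + r)"
  define o1 o2 o3 where "o1 = z + r - m - x" and "o2 = x + r - y" and "o3 = y + r - z"
  have zone: "count \<alpha> a y (x + r) + count \<alpha> b y (x + r) = x + r - y"
    if "contained \<alpha> a b c x y z" for \<alpha> a b c x y z
  proof (rule count_two)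
    show "y \<le> x + r" using that unfolding contained_def short_gaps_def by simp
    show "a \<noteq> b" using that triple_eq unfolding contained_def by blast
    show "col \<alpha> w = a \<or> col \<alpha> w = b" if "y \<le> w" "w < x + r" for w
      using contained_zone(1)[OF \<open>contained \<alpha> a b c x y z\<close> that] .
  qed
  have g2: "contained \<gamma> b c a y z (x + m)" using contained_rotate[OF \<gamma>(1)] .
  have sums: "u1 + v1 = o1" "u2 + v2 = o2" "u3 + v3 = o3"
    using zone[OF \<gamma>(1)] zone[OF g2] zone[OF contained_rotate[OF g2]]
      count_shift[of \<gamma> a x "z + r - m"] count_shift[of \<gamma> c x "z + r - m"]
    unfolding u1_def v1_def u2_def v2_def u3_def v3_def o1_def o2_def o3_def
    by (simp_all add: algebra_simps)
  let ?D = "\<lambda>s k. close (hub a b c (s + x)) \<beta> k"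
  have tot: "o1 + o2 + o3 = r - 1" unfolding o1_def o2_def o3_def using m by simp
  have "?D (t - x) (3 * r + 1 - \<epsilon> - u) \<or> ?D (t - x + u + v + \<epsilon>) (3 * r
    + 1 - \<epsilon> - v)"
  proof (rule rotating_hub_bound[OF r5 m _ _ _ _ _ _ _ _ sums tot])
    show "?D s l" if "?D s k" "k \<le> l" for s k l by (rule within_dist_mono[OF that])
    show "?D (s + m) k \<longleftrightarrow> ?D s k" for s k
      using hub_shift[of a b c "s + x"] by (simp add: algebra_simps)
    show "0 \<le> u1" "0 \<le> u2" "0 \<le> u3" "0 \<le> v1" "0 \<le> v2" "0 \<le> v3"
      unfolding u1_def u2_def u3_def v1_def v2_def v3_def by (rule count_nonneg)+
    show "0 \<le> e" "e \<le> 1" "0 \<le> f" "f \<le> 1" "0 \<le> g" "g \<le> 1" using fl by auto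
    show "2 * e \<le> o1" "2 * f \<le> o2" "2 * g \<le> o3"
      using gp m_bounds unfolding gap_ok_def o1_def o2_def o3_def by auto
    show "?D s (k1 + k2 + k3 + \<bar>q1 - s\<bar> + \<bar>q2 - s\<bar> + \<bar>q3 - s\<bar> + (e + f + g))"
      if q: "q1 = 0 \<and> k1 = u1 \<or> q1 = o1 \<and> k1 = v1"
        "q2 = o1 + o3 \<and> k2 = u2 \<or> q2 = r - 1 \<and> k2 = v2"
        "q3 = o1 \<and> k3 = u3 \<or> q3 = o1 + o3 \<and> k3 = v3" for s q1 k1 q2 k2 q3 k3
    proof -
      have "close \<gamma> (hub a b c (s + x)) (k1 + k2 + k3 + \<bar>q1 + x - (s + x)\<bar>
        + \<bar>q2 + x + 1 - (s + x + 1)\<bar> + \<bar>q3 + x + r + 1 - (s + x + r + 1)\<bar>)"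
        by (rule close_hub[OF \<gamma>(1)])
          (use q m in \<open>auto simp: u1_def v1_def u2_def v2_def u3_def v3_def o1_def o2_def
            o3_def\<close>)
      then have "close \<gamma> (hub a b c (s + x)) (k1 + k2 + k3 + \<bar>q1 - s\<bar>
        + \<bar>q2 - s\<bar> + \<bar>q3 - s\<bar>)"
        by (simp add: algebra_simps)
      from close_sym[OF within_dist_trans[OF \<gamma>(2) this]]
      show ?thesis by (simp add: algebra_simps)
    qed
    show "?D s (r - 1 - (u1 + u2 + u3) + \<bar>o1 + 2 * g - s\<bar> + \<bar>r - 1 + 2 * e - s\<bar>
      + \<bar>o1 + o3 + 2 * f - s\<bar> + (e + f + g))" for s
    proof -
      let ?k1 = "count \<delta> a (x + 2 * e) (z + 2 * g + r - m)"
      let ?k2 = "count \<delta> b (y + 2 * f) (x + 2 * e + r)"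
      let ?k3 = "count \<delta> c (z + 2 * g) (y + 2 * f + r)"
      \<comment> \<open>With \<open>F = e + f + g\<close>, the \<open>left_count\<close> of \<beta>
        is \<open>u1 + u2 + u3 + F\<close>, so its \<open>right_count\<close> is
        \<open>r - 1 + F - (u1 + u2 + u3)\<close>, and the repairs take off \<open>F\<close> once
        more.\<close>
      have "?k1 + ?k2 + ?k3 = r - 1 - (u1 + u2 + u3)"
        using lc rc left_right_count[OF \<beta>]
        unfolding left_count_def right_count_def u1_def u2_def u3_def by (simp add: algebra_simps)
      moreover have "close \<delta> (hub a b c (s + x)) (?k1 + ?k2 + ?k3 + \<bar>z + 2 * g + r - m - (s
        + x)\<bar>
        + \<bar>x + 2 * e + r - (s + x + 1)\<bar> + \<bar>y + 2 * f + r - (s + x + r + 1)\<bar>)"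
        by (rule close_hub[OF \<delta>(1)]) auto
      moreover have "z + 2 * g + r - m - (s + x) = o1 + 2 * g - s"
        "x + 2 * e + r - (s + x + 1) = r - 1 + 2 * e - s"
        "y + 2 * f + r - (s + x + r + 1) = o1 + o3 + 2 * f - s"
        unfolding o1_def o3_def using m by simp_all
      ultimately have "close \<delta> (hub a b c (s + x)) (r - 1 - (u1 + u2 + u3) + \<bar>o1 + 2 * g - s\<bar>
        + \<bar>r - 1 + 2 * e - s\<bar> + \<bar>o1 + o3 + 2 * f - s\<bar>)"
        by (simp only:)
      from close_sym[OF within_dist_trans[OF \<delta>(2) this]]
      show ?thesis by (simp add: algebra_simps)
    qed
  qed (use uv in auto)
  then show ?thesis by (simp add: algebra_simps)
qed

text \<open>The surcharge \<open>u\<close> or \<open>v\<close> for reaching a hub cancels against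
  the saving in \<open>hub_to_repairable\<close>.\<close>

lemma close_contained_repairable_same:
  assumes \<alpha>: "contained \<alpha> a b c x y z" and \<beta>: "repairable \<beta> a b c p q s e f g"
    and l: "3 * int (card {t \<in> V. \<alpha> t = a}) \<le> m"
  shows "close \<alpha> \<beta> (int (card {t \<in> V. \<alpha> t = a}) + 3 * r)"
proof -
  let ?l = "int (card {t \<in> V. \<alpha> t = a})"
  obtain t u v where uv: "0 \<le> u" "0 \<le> v" "u + v + 1 \<le> ?l"
    and h: "close \<alpha> (hub a b c t) (?l - 1 + u)" "close \<alpha> (hub a b c (t + u + v)) (?l - 1 + v)"
    using source_hub[OF \<alpha>] .
  have "3 * (u + v + 1) \<le> m" using uv l by simp
  then have "close (hub a b c t) \<beta> (3 * r + 1 - u) \<or> close (hub a b c (t + u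
    + v)) \<beta> (3 * r + 1 - v)"
    using hub_to_repairable[OF \<beta> uv(1,2), of 0 t] by simp
  then show ?thesis
  proof
    assume "close (hub a b c t) \<beta> (3 * r + 1 - u)"
    from within_dist_trans[OF h(1) this] show ?thesis by (rule within_dist_mono) simp
  next
    assume "close (hub a b c (t + u + v)) \<beta> (3 * r + 1 - v)"
    from within_dist_trans[OF h(2) this] show ?thesis by (rule within_dist_mono) simp
  qed
qed

text \<open>The first hub swaps to offset \<open>r\<close>, the second to offset
  \<open>r + 1\<close>, so the swapped hubs are one further apart. This is
  \<open>\<epsilon> = 1\<close>, and it refunds one of the two swapping steps.\<close>

lemma close_contained_repairable_opposite:
  assumes \<alpha>: "contained \<alpha> a b c x y z" and \<beta>: "repairable \<beta> a c b p q s e f g"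
    and l: "3 * int (card {t \<in> V. \<alpha> t = a}) \<le> m"
  shows "close \<alpha> \<beta> (int (card {t \<in> V. \<alpha> t = a}) + 1 + 3 * r)"
proof -
  let ?l = "int (card {t \<in> V. \<alpha> t = a})"
  obtain t u v where uv: "0 \<le> u" "0 \<le> v" "u + v + 1 \<le> ?l"
    and h: "close \<alpha> (hub a b c t) (?l - 1 + u)" "close \<alpha> (hub a b c (t + u + v)) (?l - 1 + v)"
    using source_hub[OF \<alpha>] .
  have abc: "{a, b, c} = {1..3}" using \<alpha> unfolding contained_def by blast
  have "3 * (u + v + 1) \<le> m" using uv l by simp
  then have "close (hub a c b (t + r)) \<beta> (3 * r - u) \<or>
      close (hub a c b (t + r + u + v + 1)) \<beta> (3 * r - v)"
    using hub_to_repairable[OF \<beta> uv(1,2), of 1 "t + r"] by simp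
  then show ?thesis
  proof
    assume "close (hub a c b (t + r)) \<beta> (3 * r - u)"
    from within_dist_trans[OF h(1) within_dist_trans[OF hub_swap(1)[OF abc] this]]
    show ?thesis by (rule within_dist_mono) simp
  next
    assume 1: "close (hub a c b (t + r + u + v + 1)) \<beta> (3 * r - v)"
    have "t + r + u + v + 1 = t + u + v + r + 1" by simp
    with 1 have "close (hub a c b (t + u + v + r + 1)) \<beta> (3 * r - v)" by (simp only:)
    from within_dist_trans[OF h(2) within_dist_trans[OF hub_swap(2)[OF abc] this]]
    show ?thesis by (rule within_dist_mono) simp
  qed
qed

lemma small_class:
  assumes "\<alpha> \<in> V \<rightarrow>\<^sub>E {1..3}" "{a, b, c} = {1..3::nat}"
  obtains i where "i \<in> {a, b, c}" "3 * int (card {t \<in> V. \<alpha> t = i}) \<le> m"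
proof -
  let ?n = "\<lambda>i. card {t \<in> V. \<alpha> t = i}"
  note ne = triple_eq[OF assms(2)]
  have "V = {t \<in> V. \<alpha> t = a} \<union> {t \<in> V. \<alpha> t
    = b} \<union> {t \<in> V. \<alpha> t = c}"
    using assms(1) unfolding assms(2)[symmetric] by (auto simp: PiE_iff)
  then have "card V = card ({t \<in> V. \<alpha> t = a} \<union> {t \<in> V. \<alpha> t
    = b} \<union> {t \<in> V. \<alpha> t = c})"
    by (rule arg_cong)
  also have "\<dots> = card ({t \<in> V. \<alpha> t = a} \<union> {t \<in> V. \<alpha> t = b}) + ?n c"
    using ne finite_V by (intro card_Un_disjoint) auto
  also have "card ({t \<in> V. \<alpha> t = a} \<union> {t \<in> V. \<alpha> t = b}) = ?n a + ?n b"
    using ne finite_V by (intro card_Un_disjoint) auto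
  finally have "?n a + ?n b + ?n c = card V" by simp
  moreover have "int (card V) = m" unfolding V_def using m_pos by simp
  ultimately have "3 * int (?n a) \<le> m \<or> 3 * int (?n b) \<le> m \<or> 3 * int (?n c) \<le> m"
    by linarith
  then show ?thesis using that by blast
qed

text \<open>Rotating the names of the colours in both colourings puts a class of \<alpha> with at
  most \<open>m div 3\<close> vertices first.\<close>

lemma close_contained_repairable_oriented:
  assumes \<alpha>: "contained \<alpha> a b c x y z" and \<beta>: "repairable \<beta> a b c p q s e f g"
  shows "close \<alpha> \<beta> (3 * r + m div 3)"
proof -
  have rot: "close \<alpha> \<beta> (3 * r + m div 3)"
    if "contained \<alpha> a b c x y z" "repairable \<beta> a b c p q s e f g"
      "3 * int (card {t \<in> V. \<alpha> t = a}) \<le> m"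
    for a b c x y z p q s e f g
    by (rule within_dist_mono[OF close_contained_repairable_same[OF that]]) (use that(3) in linarith)
  obtain i where i: "i \<in> {a, b, c}" "3 * int (card {t \<in> V. \<alpha> t = i}) \<le> m"
    using small_class \<alpha> unfolding contained_def by blast
  note \<alpha>2 = contained_rotate[OF \<alpha>] and \<beta>2 = repairable_rotate[OF \<beta>]
  show ?thesis
    using i rot[OF \<alpha> \<beta>] rot[OF \<alpha>2 \<beta>2]
    rot[OF contained_rotate[OF \<alpha>2] repairable_rotate[OF \<beta>2]] by blast
qed

text \<open>The six orders of three colours are three rotations, which need no swap, and three
  reversals. For a reversal both colourings are rotated so that the same small colour comes
  first.\<close>

lemma close_contained_repairable:
  assumes \<alpha>: "contained \<alpha> a b c x y z" and \<beta>: "repairable \<beta> a' b' c' p q s e f g"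
  shows "close \<alpha> \<beta> (3 * r + m div 3 + 1)"
proof -
  have opp: "close \<alpha> \<beta> (3 * r + m div 3 + 1)"
    if "contained \<alpha> a b c x y z" "repairable \<beta> a c b p q s e f g"
      "3 * int (card {t \<in> V. \<alpha> t = a}) \<le> m"
    for a b c x y z p q s e f g
    by (rule within_dist_mono[OF close_contained_repairable_opposite[OF that]]) (use that(3) in linarith)
  obtain i where i: "i \<in> {a, b, c}" "3 * int (card {t \<in> V. \<alpha> t = i}) \<le> m"
    using small_class \<alpha> unfolding contained_def by blast
  note \<alpha>2 = contained_rotate[OF \<alpha>] and \<beta>2 = repairable_rotate[OF \<beta>]
  note \<alpha>3 = contained_rotate[OF \<alpha>2] and \<beta>3 = repairable_rotate[OF \<beta>2]
  have abc: "{a, b, c} = {1..3}" and abc': "{a', b', c'} = {1..3}"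
    using \<alpha> \<beta> unfolding contained_def repairable_def by blast+
  from triple_perm[OF abc abc'] show ?thesis
  proof cases
    case 1
    then show ?thesis using within_dist_mono[OF close_contained_repairable_oriented[OF \<alpha>]] \<beta>
      by simp
  next
    case 2
    then show ?thesis using within_dist_mono[OF close_contained_repairable_oriented[OF \<alpha>2]]
      \<beta> by simp
  next
    case 3
    then show ?thesis using within_dist_mono[OF close_contained_repairable_oriented[OF \<alpha>3]]
      \<beta> by simp
  next
    case 4
    then show ?thesis using i opp[OF \<alpha>] opp[OF \<alpha>2] opp[OF \<alpha>3] \<beta> \<beta>2
      \<beta>3 by blast
  next
    case 5
    then show ?thesis using i opp[OF \<alpha>] opp[OF \<alpha>2] opp[OF \<alpha>3] \<beta> \<beta>2
      \<beta>3 by blast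
  next
    case 6
    then show ?thesis using i opp[OF \<alpha>] opp[OF \<alpha>2] opp[OF \<alpha>3] \<beta> \<beta>2
      \<beta>3 by blast
  qed
qed

text \<open>In these colourings the arcs of classes \<open>a\<close> and \<open>b\<close> interlock, so that both cyclic orders of
  the three classes are one step away.\<close>

definition interlocked ::
  "(int \<Rightarrow> nat) \<Rightarrow> nat \<Rightarrow> nat \<Rightarrow> nat \<Rightarrow> int
    \<Rightarrow> bool" where
  "interlocked \<alpha> a b c p \<longleftrightarrow> \<alpha> \<in> V \<rightarrow>\<^sub>E {1..3}
    \<and> {a, b, c} = {1..3} \<and>
     col \<alpha> p = a \<and> col \<alpha> (p + r + 1) = a \<and> col \<alpha> (p + 1) = b \<and> col
       \<alpha> (p + r) = b \<and>
     (\<forall>z. p + 1 < z \<and> z < p + r \<longrightarrow> col \<alpha> z = a \<or> col \<alpha> z =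
       b) \<and>
     (\<forall>z. p + r + 1 < z \<and> z < p + m \<longrightarrow> col \<alpha> z = c)"

text \<open>Handing \<open>p + r + 1\<close> to \<open>c\<close> leaves \<open>a\<close> on a window
  starting at \<open>p\<close>, just before that of \<open>b\<close>; handing \<open>p\<close> to
  \<open>c\<close> leaves it on a window starting at \<open>p + 2\<close>, just after that of
  \<open>b\<close>.\<close>

lemma interlocked_contained:
  assumes \<alpha>: "interlocked \<alpha> a b c p"
  shows "\<alpha> \<in> colorings"
    and "\<exists>\<beta>. close \<alpha> \<beta> 1 \<and> contained \<beta> a b c p (p + 1) (p + r + 1)"
    and "\<exists>\<beta>. close \<alpha> \<beta> 1 \<and> contained \<beta> b a c (p + 1) (p + 2) (p + r
      + 2)"
proof -
  have rng: "\<alpha> \<in> V \<rightarrow>\<^sub>E {1..3}" and abc: "{a, b, c} = {1..3}"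
    and pt: "col \<alpha> p = a" "col \<alpha> (p + r + 1) = a" "col \<alpha> (p + 1) = b"
      "col \<alpha> (p + r) = b"
    and mid: "\<And>z. p + 1 < z \<Longrightarrow> z < p + r \<Longrightarrow> col \<alpha> z = a
      \<or> col \<alpha> z = b"
    and up: "\<And>z. p + r + 1 < z \<Longrightarrow> z < p + m \<Longrightarrow> col \<alpha> z = c"
    using \<alpha> unfolding interlocked_def by auto
  note ne = triple_eq[OF abc]
  have class_a: "w = p \<or> p + 1 < w \<and> w < p + r \<or> w = p + r + 1"
    if "p \<le> w" "w < p + m" "col \<alpha> w = a" for w
  proof -
    have "w \<noteq> p + 1" "w \<noteq> p + r" using that(3) pt ne by auto
    moreover have "w \<le> p + r + 1" using up[of w] that ne by force
    ultimately show ?thesis using that by linarith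
  qed
  have class_b: "p + 1 \<le> w \<and> w \<le> p + r" if "p \<le> w" "w < p + m" "col \<alpha> w = b" for w
  proof -
    have "w \<noteq> p" "w \<noteq> p + r + 1" using that(3) pt ne by auto
    moreover have "w \<le> p + r + 1" using up[of w] that ne by force
    ultimately show ?thesis using that by linarith
  qed
  have class_c: "p + r + 1 < w" if "p \<le> w" "w < p + m" "col \<alpha> w = c" for w
  proof -
    have "w \<noteq> p" "w \<noteq> p + 1" "w \<noteq> p + r" "w \<noteq> p + r + 1" using that(3) pt ne
      by auto
    moreover have "\<not> (p + 1 < w \<and> w < p + r)" using mid[of w] that(3) ne by auto
    ultimately show ?thesis using that by linarith
  qed
  have fitsI: "fits \<beta> i (p + d) 0"
    if "0 \<le> d" "d < m"
      "\<And>w. p \<le> w \<Longrightarrow> w < p + m \<Longrightarrow> col \<beta> w = i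
        \<Longrightarrow> p + d \<le> w \<and> w < p + d + r \<or> w + m < p + d + r"
    for \<beta> i d
    unfolding fits_def
  proof (intro allI impI, elim conjE)
    fix w assume w: "p + d \<le> w" "w < p + d + m" "col \<beta> w = i"
    have "w < p + d + r"
    proof (cases "w < p + m")
      case True
      then show ?thesis using that(3)[of w] w that(1) m_bounds r5 by auto
    next
      case False
      then show ?thesis using that(3)[of "w - m"] w that(1,2) by auto
    qed
    then show "w < p + d + r + 2 * 0 \<and> (0 = (1::int) \<longrightarrow> w \<noteq> p + d + 1
      \<and> w \<noteq> p + d + r)" by simp
  qed
  have "fits \<alpha> a p 1"
    unfolding fits_def using class_a r5 by force
  moreover have "fits \<alpha> b (p + 1) 0"
    by (rule fitsI) (use m_bounds r5 in \<open>auto dest: class_b\<close>)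
  moreover have "fits \<alpha> c (p + (r + 2)) 0"
    by (rule fitsI) (use m_bounds r5 in \<open>auto dest: class_c\<close>)
  ultimately show valid: "\<alpha> \<in> colorings"
    using coloringI[OF rng abc] by blast
  show "\<exists>\<beta>. close \<alpha> \<beta> 1 \<and> contained \<beta> a b c p (p + 1) (p + r + 1)"
  proof -
    let ?\<beta> = "\<alpha>((p + r + 1) mod m := c)"
    have col: "col ?\<beta> w = (if w = p + r + 1 then c else col \<alpha> w)"
      if "p \<le> w" "w < p + m" for w
      using col_upd[OF that, of "p + r + 1"] m_bounds r5 by simp
    have "fits ?\<beta> a (p + 0) 0"
      by (rule fitsI) (use ne m_bounds r5 in \<open>auto simp: col split: if_splits dest: class_a\<close>)
    moreover have "fits ?\<beta> b (p + 1) 0"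
      by (rule fitsI) (use ne m_bounds r5 in \<open>auto simp: col split: if_splits dest: class_b\<close>)
    moreover have "fits ?\<beta> c (p + (r + 1)) 0"
      by (rule fitsI) (use ne m_bounds r5 in \<open>auto simp: col split: if_splits dest: class_c\<close>)
    moreover have "short_gaps p (p + 1) (p + r + 1)" unfolding short_gaps_def using m_bounds r5 by auto
    ultimately have "contained ?\<beta> a b c p (p + 1) (p + r + 1)"
      unfolding contained_def using upd_in[OF rng] ne abc by (simp add: add.assoc)
    then show ?thesis using close_upd[OF valid contained_coloring] by blast
  qed
  show "\<exists>\<beta>. close \<alpha> \<beta> 1 \<and> contained \<beta> b a c (p + 1) (p + 2) (p + r + 2)"
  proof -
    let ?\<beta> = "\<alpha>(p mod m := c)"
    have col: "col ?\<beta> w = (if w = p then c else col \<alpha> w)" if "p \<le> w" "w < p + m" for w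
      using col_upd[OF that, of p] m_bounds r5 by simp
    have "fits ?\<beta> a (p + 2) 0"
      by (rule fitsI) (use ne m_bounds r5 in \<open>auto simp: col split: if_splits dest: class_a\<close>)
    moreover have "fits ?\<beta> b (p + 1) 0"
      by (rule fitsI) (use ne m_bounds r5 in \<open>auto simp: col split: if_splits dest: class_b\<close>)
    moreover have "fits ?\<beta> c (p + (r + 2)) 0"
      by (rule fitsI) (use ne m_bounds r5 in \<open>auto simp: col split: if_splits dest: class_c\<close>)
    moreover have "short_gaps (p + 1) (p + 2) (p + r + 2)" unfolding short_gaps_def using m_bounds r5 by auto
    ultimately have "contained ?\<beta> b a c (p + 1) (p + 2) (p + r + 2)"
      unfolding contained_def using upd_in[OF rng] ne abc by (simp add: add.assoc insert_commute)
    then show ?thesis using close_upd[OF valid contained_coloring] by blast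
  qed
qed

lemma interlocked_any_order:
  assumes \<alpha>: "interlocked \<alpha> a b c p" and abc': "{a', b', c'} = {1..3::nat}"
  shows "\<exists>\<beta> x y z. close \<alpha> \<beta> 1 \<and> contained \<beta> a' b' c' x y z"
proof -
  have abc: "{a, b, c} = {1..3}" using \<alpha> unfolding interlocked_def by blast
  obtain \<beta> \<gamma> where f: "close \<alpha> \<beta> 1" "contained \<beta> a b c p (p + 1) (p + r + 1)"
    and g: "close \<alpha> \<gamma> 1" "contained \<gamma> b a c (p + 1) (p + 2) (p + r + 2)"
    using interlocked_contained(2,3)[OF \<alpha>] by blast
  note f2 = contained_rotate[OF f(2)] and g2 = contained_rotate[OF g(2)]
  from triple_perm[OF abc abc'] show ?thesis
    using f g f2 g2 contained_rotate[OF f2] contained_rotate[OF g2] by cases blast+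
qed

end

section \<open>Classification of the colourings\<close>

context circulant
begin

lemma interlocked_near:
  assumes \<alpha>: "\<alpha> \<in> colorings" and \<beta>: "interlocked (\<alpha>(x mod m := i)) a b c p"
  shows "\<exists>\<beta> a b c p. close \<alpha> \<beta> 1 \<and> interlocked \<beta> a b c p"
  using close_upd[OF \<alpha> interlocked_contained(1)[OF \<beta>]] \<beta> by blast

lemma mod_eq_multiple:
  assumes "z mod m = w mod m"
  shows "z = w + (z div m - w div m) * m"
  using div_mult_mod_eq[of z m] div_mult_mod_eq[of w m] assms unfolding left_diff_distrib by linarith

lemma fits_cong: "p mod m = q mod m
  \<Longrightarrow> fits \<alpha> i p e \<longleftrightarrow> fits \<alpha> i q e"
  by (subst mod_eq_multiple) (auto simp: fits_shift)

lemma col_add_cong: "p mod m = q mod m \<Longrightarrow> col \<alpha> (p + d) = col \<alpha> (q + d)"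
  by (intro col_cong mod_add_cong) auto

text \<open>Placing the start of a class in a prescribed turn allows the starts of different classes
  to be compared as integers.\<close>

lemma class_type_window:
  assumes "\<alpha> \<in> colorings" "col \<alpha> w = i"
  obtains (ends) s e where "t < s" "s \<le> t + m" "col \<alpha> s = i" "ends \<alpha> i s e"
  | (triple) s where "t < s" "s \<le> t + m"
      "\<And>z. s \<le> z \<Longrightarrow> z < s + m \<Longrightarrow> col \<alpha> z = i
        \<Longrightarrow> z = s \<or> z = s + r \<or> z = s + r + 1"
      "col \<alpha> s = i" "col \<alpha> (s + r) = i" "col \<alpha> (s + r + 1) = i"
proof -
  have window: "\<exists>s. t < s \<and> s \<le> t + m \<and> s mod m = q mod m" for q
  proof -
    obtain s where "t + 1 \<le> s" "s < t + 1 + m" "s mod m = q mod m"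
      using residue_window[OF m_pos] by blast
    then show ?thesis by (intro exI[of _ s]) auto
  qed
  show ?thesis
    using assms
  proof (cases rule: class_type)
    case (arc q)
    obtain s where s: "t < s" "s \<le> t + m" "s mod m = q mod m" using window by blast
    show ?thesis
      using ends[OF s(1,2), of 0] arc fits_cong[OF s(3)] col_cong[OF s(3)] unfolding ends_def by simp
  next
    case (gapped q)
    obtain s where s: "t < s" "s \<le> t + m" "s mod m = q mod m" using window by blast
    show ?thesis
      using ends[OF s(1,2), of 1] gapped fits_cong[OF s(3)] col_cong[OF s(3)]
      col_add_cong[OF s(3), of \<alpha> "r + 1"]
      unfolding ends_def by (simp add: add.assoc)
  next
    case (triple q)
    obtain s where s: "t < s" "s \<le> t + m" "s mod m = q mod m" using window by blast
    show ?thesis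
    proof (rule that(2)[OF s(1,2)])
      show "col \<alpha> s = i" "col \<alpha> (s + r) = i" "col \<alpha> (s + r + 1) = i"
        using triple col_cong[OF s(3)] col_add_cong[OF s(3), of \<alpha> r]
        col_add_cong[OF s(3), of \<alpha> "r + 1"]
        by (simp_all add: add.assoc)
      fix z assume z: "s \<le> z" "z < s + m" "col \<alpha> z = i"
      have "(z - s + q) mod m = z mod m"
        using mod_add_cong[OF refl s(3)[symmetric], of "z - s"] by simp
      then have "col \<alpha> (z - s + q) = i" using z(3) col_cong by metis
      then show "z = s \<or> z = s + r \<or> z = s + r + 1" using triple(4)[of "z - s + q"] z by auto
    qed
  qed
qed

text \<open>Two acyclic classes cannot cover the tournament, because the complement of each type of
  class contains a directed triangle. Hence no class is empty, and each has a start.\<close>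

lemma all_colors_used:
  assumes \<alpha>: "\<alpha> \<in> colorings" and i: "i \<in> {1..3}"
  shows "\<exists>w. col \<alpha> w = i"
proof (rule ccontr)
  assume no: "\<nexists>w. col \<alpha> w = i"
  have rng: "\<alpha> \<in> V \<rightarrow>\<^sub>E {1..3}" using \<alpha> colorings_iff by blast
  have two: False if jk: "{i, j, k} = {1..3}" and w: "col \<alpha> w = j" for j k w
  proof -
    have k: "col \<alpha> z = k" if "col \<alpha> z \<noteq> j" for z
      using col_cases[OF rng jk, of z] no that by blast
    show False
      using \<alpha> w
    proof (cases rule: class_type)
      case (arc p)
      have "col \<alpha> z = k" if "p + r \<le> z" "z < p + m" for z
        using k fitsD(1)[OF arc(2), of z] that r5 by auto
      then have "col \<alpha> (p + r) = k" "col \<alpha> (p + r + 2) = k" "col \<alpha> (p + 2 * r) = k"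
        using m_bounds r5 by auto
      then show False
        by (rule no_triangle[OF \<alpha>]) (use m_bounds r5 in \<open>auto simp: conn_def\<close>)
    next
      case (gapped p)
      have "col \<alpha> z = k" if "p + r + 1 < z" "z < p + m" for z
        using k fitsD(1)[OF gapped(3), of z] that r5 by auto
      moreover have "col \<alpha> (p + r) = k"
        using k fitsD(3)[OF gapped(3), of "p + r"] m_bounds r5 by auto
      ultimately have "col \<alpha> (p + r) = k" "col \<alpha> (p + r + 2) = k" "col \<alpha> (p + 2 * r) = k"
        using m_bounds r5 by auto
      then show False
        by (rule no_triangle[OF \<alpha>]) (use m_bounds r5 in \<open>auto simp: conn_def\<close>)
    next
      case (triple p)
      have "col \<alpha> z = k" if "p < z" "z < p + m" "z \<noteq> p + r" "z \<noteq> p + r + 1" for z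
        using k triple(4)[of z] that by auto
      then have "col \<alpha> (p + 2) = k" "col \<alpha> (p + r - 1) = k" "col \<alpha> (p + r + 2) = k"
        using m_bounds r5 by auto
      then show False
        by (rule no_triangle[OF \<alpha>]) (use m_bounds r5 in \<open>auto simp: conn_def\<close>)
    qed
  qed
  obtain j k where jk: "{i, j, k} = {1..3}"
  proof -
    have "{1..3} = {1, 2, 3::nat}" by auto
    moreover from this i have "i = 1 \<or> i = 2 \<or> i = 3" by auto
    ultimately show thesis using that[of 2 3] that[of 1 3] that[of 1 2] by auto
  qed
  then have kj: "{i, k, j} = {1..3}" by (simp add: insert_commute)
  show False using two[OF jk, of 0] two[OF kj, of 0] col_cases[OF rng jk, of 0] no by blast
qed

text \<open>A class \<open>{p, p + r, p + r + 1}\<close> determines the rest: monochromatic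
  triangles force one colour strictly between \<open>p\<close> and \<open>p + r\<close> and the
  other colour after \<open>p + r + 1\<close>.\<close>

lemma triple_near_interlocked:
  assumes \<alpha>: "\<alpha> \<in> colorings" and abc: "{a, b, c} = {1..3::nat}"
    and pa: "col \<alpha> p = a" "col \<alpha> (p + r) = a" "col \<alpha> (p + r + 1) = a" and pb:
      "col \<alpha> (p + 1) = b"
    and only: "\<And>z. p \<le> z \<Longrightarrow> z < p + m \<Longrightarrow> col \<alpha> z = a
      \<Longrightarrow> z = p \<or> z = p + r \<or> z = p + r + 1"
  shows "\<exists>\<beta> a b c p. close \<alpha> \<beta> 1 \<and> interlocked \<beta> a b c p"
proof -
  note ne = triple_eq[OF abc]
  have rng: "\<alpha> \<in> V \<rightarrow>\<^sub>E {1..3}" using \<alpha> colorings_iff by blast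
  note nt = no_triangle[OF \<alpha>]
  note mb = m_bounds r5
  have bc: "col \<alpha> z = b \<or> col \<alpha> z = c"
    if "p < z" "z < p + m" "z \<noteq> p + r" "z \<noteq> p + r + 1" for z
    using col_cases[OF rng abc, of z] only[of z] that by auto
  \<comment> \<open>The only part that triangles alone do not settle. If \<open>b\<close> lies on
    both sides of \<open>p\<close>, then first \<open>b\<close> and \<open>c\<close> are shown to
    have windows, and their starts \<open>s\<close> and \<open>q\<close> are compared.\<close>
  have top: "col \<alpha> (p + 2 * r) = c"
  proof (rule ccontr)
    assume "\<not> ?thesis"
    then have b0: "col \<alpha> (p + 2 * r) = b" "col \<alpha> (p + 2 * r - m) = b"
      using bc[of "p + 2 * r"] mb by auto
    have 1: "col \<alpha> (p + r - 1) = c"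
      using nt[of "p + 2 * r - m" b "p + 1" "p + r - 1"] b0 pb bc[of "p + r - 1"] mb by (auto simp: conn_def)
    have 2: "col \<alpha> (p + r + 2) = c"
      using nt[of "p + 1" b "p + r + 2" "p + 2 * r"] b0 pb bc[of "p + r + 2"] mb by (auto simp: conn_def)
    have 3: "col \<alpha> (p + 2 * r - 1) = b"
      using nt[of "p + r - 1" c "p + r + 2" "p + 2 * r - 1"] 1 2 bc[of "p + 2 * r - 1"] mb
      by (auto simp: conn_def)
    have 4: "col \<alpha> (p + 2) = b"
      using nt[of "p + 2" c "p + r - 1" "p + r + 2"] 1 2 bc[of "p + 2"] mb by (auto simp: conn_def)
    have 5: "col \<alpha> (p + 2 * r - 1 - m) = b" using 3 by simp
    obtain s e where s: "s \<le> p" "p - m < s" "ends \<alpha> b s e" "col \<alpha> s = b"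
      using \<alpha> pb
    proof (cases rule: class_type_window[where t = "p - m"])
      case (ends s e)
      then show ?thesis using that by simp
    next
      case (triple s)
      \<comment> \<open>Colour \<open>b\<close> occurs at \<open>p + 1\<close>,
        \<open>p + 2\<close>, \<open>p + 2 * r - 1\<close> and \<open>p + 2 * r\<close>, too many
        vertices for a triple.\<close>
      have in_s: "z = s \<or> z = s + r \<or> z = s + r + 1 \<or> z = s + m \<or> z = s + r + m \<or> z
        = s + r + 1 + m"
        if "col \<alpha> z = b" "s \<le> z" "z < s + 2 * m" for z
        using triple(3)[of z] triple(3)[of "z - m"] that by force
      show ?thesis
        using in_s[OF pb] in_s[OF 4] in_s[OF 3] in_s[OF b0(1)] triple(1,2) mb by (smt (verit))
    qed
    obtain q g where q: "q \<le> p + r" "p + r - m < q" "ends \<alpha> c q g" "col \<alpha> q = c"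
      using \<alpha> 1
    proof (cases rule: class_type_window[where t = "p + r - m"])
      case (ends s e)
      then show ?thesis using that by simp
    next
      case (triple s)
      \<comment> \<open>With \<open>p + r - 1\<close> and \<open>p + r + 2\<close> this makes four
        vertices of colour \<open>c\<close>, again too many for a triple.\<close>
      have 6: "col \<alpha> (p + r - 2) = c"
        using nt[of "p + 1" b "p + r - 2" "p + 2 * r - 1"] 3 pb bc[of "p + r - 2"] mb by (auto simp: conn_def)
      have 7: "col \<alpha> (p + r + 3) = c"
        using nt[of "p + 2" b "p + r + 3" "p + 2 * r"] 4 b0 bc[of "p + r + 3"] mb by (auto simp: conn_def)
      have in_s: "z = s \<or> z = s + r \<or> z = s + r + 1 \<or> z = s + m \<or> z = s + r + m \<or> z
        = s + r + 1 + m"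
        if "col \<alpha> z = c" "s \<le> z" "z < s + 2 * m" for z
        using triple(3)[of z] triple(3)[of "z - m"] that by force
      have in_s': "z = s \<or> z = s + r \<or> z = s + r + 1 \<or> z = s + m \<or> z = s + r + m \<or> z
        = s + r + 1 + m \<or> z = s - m \<or> z = s + r - m \<or> z = s + r + 1 - m"
        if "col \<alpha> z = c" "s - m \<le> z" "z < s + 2 * m" for z
        using in_s[of z] in_s[of "z + m"] that by force
      show ?thesis
        using in_s'[OF 6] in_s'[OF 1] in_s'[OF 2] in_s'[OF 7] triple(1,2) mb by (smt (z3))
    qed
    have e: "e = 0 \<or> e = 1" "fits \<alpha> b s e" and g: "g = 0 \<or> g = 1" "fits \<alpha> c q g"
      using s(3) q(3) unfolding ends_def by auto
    have "s \<noteq> p" "q \<noteq> p + r" using s(4) q(4) pa ne by auto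
    then have s0: "s < p" and q0: "q < p + r" using s q by auto
    have s1: "p + 2 - r \<le> s"
    proof -
      have "s \<noteq> p + 1 - m" using fitsD(1)[OF e(2), of "p + 2 * r - m"] b0(2) e(1) mb by auto
      moreover have "s \<noteq> p - r"
        using s(4) pa(3) col_shift(2)[of \<alpha> "p + r + 1"] ne m by auto
      ultimately show ?thesis
        using fitsD[OF e(2), of "p + 1"] pb e(1) s s0 by auto
    qed
    have q1: "p + 3 \<le> q"
    proof -
      have "q \<noteq> p + 1" using q(4) pb ne by auto
      have "p + r + 2 < q + m"
      proof (rule ccontr)
        assume "\<not> ?thesis"
        then have "q \<le> p + r + 2 - m" by simp
        then show False using fitsD(1)[OF g(2), of "p + r - 1"] 1 g(1) q mb r5 by auto
      qed
      then show ?thesis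
        using fitsD[OF g(2), of "p + r + 2"] 2 g(1) q q0 \<open>q \<noteq> p + 1\<close> by auto
    qed
    have sr: "col \<alpha> (s + r) \<noteq> b" using fitsD[OF e(2), of "s + r"] e(1) mb by auto
    then have "col \<alpha> (s + r) = c" using bc[of "s + r"] s0 s1 mb by auto
    then have 8: "q \<le> s + r" using fitsD(1)[OF g(2), of "s + r + m"] g(1) s0 s1 q0 q1 mb by force
    have "col \<alpha> (q + r) \<noteq> c" using fitsD[OF g(2), of "q + r"] g(1) mb by auto
    then have "col \<alpha> (q + r) = b" using bc[of "q + r"] q0 q1 mb by auto
    then show False using fitsD(1)[OF e(2), of "q + r"] e(1) 8 s0 s1 q0 q1 mb by auto
  qed
  have top': "col \<alpha> (p + 2 * r - m) = c" using top by simp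
  have b_right: "col \<alpha> z = c"
    if "col \<alpha> (p + r + 2) = b" "p + r + 3 \<le> z" "z \<le> p + 2 * r" for z
    using nt[of "p + 1" b "p + r + 2" z] pb that bc[of z] mb by (auto simp: conn_def)
  have c_left: "col \<alpha> z = b"
    if "col \<alpha> (p + r - 1) = c" "p + 1 \<le> z" "z \<le> p + r - 2" for z
    using nt[of "p + 2 * r - m" c z "p + r - 1"] top' that bc[of z] mb by (auto simp: conn_def)
  have 1: "col \<alpha> (p + r - 1) = b"
  proof (rule ccontr)
    assume "\<not> ?thesis"
    then have c1: "col \<alpha> (p + r - 1) = c" using bc[of "p + r - 1"] mb by auto
    show False
    proof (cases "col \<alpha> (p + r + 2) = b")
      case True
      then show False
        using nt[of "p + r - 1" c "p + r + 3" "p + 2 * r - 1"] c1 b_right[OF True] mb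
        by (auto simp: conn_def)
    next
      case False
      then have c2: "col \<alpha> (p + r + 2) = c" using bc[of "p + r + 2"] mb by auto
      have "col \<alpha> (p + 2 * r - 1) = c"
        using nt[of "p + 1" b "p + r - 2" "p + 2 * r - 1"] pb c_left[OF c1, of "p + r - 2"]
          bc[of "p + 2 * r - 1"] mb by (auto simp: conn_def)
      then show False
        using nt[of "p + r - 1" c "p + r + 2" "p + 2 * r - 1"] c1 c2 mb by (auto simp: conn_def)
    qed
  qed
  have 2: "col \<alpha> (p + r + 2) = c"
  proof (rule ccontr)
    assume "\<not> ?thesis"
    then have b2: "col \<alpha> (p + r + 2) = b" using bc[of "p + r + 2"] mb by auto
    have "col \<alpha> (p + 2) = b"
      using nt[of "p + 2" c "p + r + 3" "p + 2 * r"] top b_right[OF b2, of "p + r + 3"] bc[of "p + 2"] mb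
      by (auto simp: conn_def)
    then show False
      using nt[of "p + 2" b "p + r - 1" "p + r + 2"] 1 b2 mb by (auto simp: conn_def)
  qed
  have low: "col \<alpha> z = b" if z: "p + 1 \<le> z" "z \<le> p + r - 1" for z
  proof (rule ccontr)
    assume "col \<alpha> z \<noteq> b"
    then have cz: "col \<alpha> z = c" "z \<noteq> p + r - 1" "z \<noteq> p + 1" using bc[of z] z 1 pb mb
      by auto
    show False
    proof (cases "z = p + 2")
      case True
      then have "col \<alpha> (p + r + 3) = b"
        using nt[of "p + 2" c "p + r + 3" "p + 2 * r"] cz top bc[of "p + r + 3"] mb by (auto simp: conn_def)
      then show False
        using nt[of "p + 1" b "p + r - 1" "p + r + 3"] 1 pb mb by (auto simp: conn_def)
    next
      case False
      then show False
        using nt[of z c "p + r + 2" "p + 2 * r"] 2 top cz z mb by (auto simp: conn_def)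
    qed
  qed
  have high: "col \<alpha> z = c" if z: "p + r + 2 \<le> z" "z \<le> p + 2 * r" for z
  proof (rule ccontr)
    assume "col \<alpha> z \<noteq> c"
    then have bz: "col \<alpha> z = b" "z \<noteq> p + r + 2" "z \<noteq> p + 2 * r"
      using bc[of z] z 2 top mb by auto
    show False
    proof (cases "z = p + 2 * r - 1")
      case True
      then show False
        using nt[of "p + 1" b "p + r - 2" z] bz pb low[of "p + r - 2"] mb by (auto simp: conn_def)
    next
      case False
      then show False
        using nt[of "p + 1" b "p + r - 1" z] 1 bz pb z mb by (auto simp: conn_def)
    qed
  qed
  \<comment> \<open>Handing \<open>p + r\<close> to \<open>b\<close> leaves \<open>a\<close> on
    \<open>p\<close> and \<open>p + r + 1\<close> only, the two ends of an interlocked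
    pattern.\<close>
  let ?\<beta> = "\<alpha>((p + r) mod m := b)"
  have col: "col ?\<beta> w = (if w = p + r then b else col \<alpha> w)" if "p \<le> w" "w < p + m" for w
    using col_upd[OF that, of "p + r"] mb by simp
  have "interlocked ?\<beta> a b c p"
    unfolding interlocked_def
    using upd_in[OF rng ne(5)] abc pa pb low high mb by (auto simp: col)
  then show ?thesis by (rule interlocked_near[OF \<alpha>])
qed

text \<open>If both holes of a gapped class have colour \<open>b\<close>, triangles through them
  force \<open>c\<close> after \<open>p + r + 1\<close>, except at one of the two extreme positions
  \<open>p + r + 2\<close> and \<open>p + 2 * r\<close>. Recolouring that exception gives the
  pattern.\<close>

lemma gapped_near_interlocked:
  assumes \<alpha>: "\<alpha> \<in> colorings" and abc: "{a, b, c} = {1..3::nat}"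
    and pa: "col \<alpha> p = a" "col \<alpha> (p + r + 1) = a" and fit: "fits \<alpha> a p 1"
    and pb: "col \<alpha> (p + 1) = b" "col \<alpha> (p + r) = b"
  shows "\<exists>\<beta> a b c p. close \<alpha> \<beta> 1 \<and> interlocked \<beta> a b c p"
proof -
  note ne = triple_eq[OF abc]
  have rng: "\<alpha> \<in> V \<rightarrow>\<^sub>E {1..3}" using \<alpha> colorings_iff by blast
  note nt = no_triangle[OF \<alpha>]
  note mb = m_bounds r5
  have bc: "col \<alpha> z = b \<or> col \<alpha> z = c" if "p + r + 1 < z" "z < p + m" for z
    using col_cases[OF rng abc, of z] fitsD(1)[OF fit, of z] that r5 by auto
  have high: "col \<alpha> z = c" if z: "p + r + 3 \<le> z" "z \<le> p + 2 * r - 1" for z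
    using nt[of "p + 1" b "p + r" z] pb bc[of z] z mb by (auto simp: conn_def)
  have one: "col \<alpha> (p + r + 2) = c \<or> col \<alpha> (p + 2 * r) = c"
    using nt[of "p + 1" b "p + r + 2" "p + 2 * r"] pb bc[of "p + r + 2"] bc[of "p + 2 * r"] mb
    by (auto simp: conn_def)
  have low: "col \<alpha> z = a \<or> col \<alpha> z = b" if z: "p + 1 < z" "z < p + r" for z
  proof (rule ccontr)
    assume "\<not> ?thesis"
    then have cz: "col \<alpha> z = c" using col_cases[OF rng abc, of z] by auto
    \<comment> \<open>The triangle \<open>z\<close>, \<open>p + r + 3\<close>,
      \<open>p + 2 * r - 1\<close> fails only where a difference equals \<open>r\<close>, that is
      for \<open>z = p + 3\<close> and \<open>z = p + r - 2\<close>. Its middle difference is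
      \<open>r - 4\<close>, which is positive because \<open>r \<ge> 5\<close>.\<close>
    consider "z = p + 3" | "z \<noteq> p + 3" "z = p + r - 2" | "z \<noteq> p + 3" "z \<noteq> p + r - 2"
      by blast
    then show False
    proof cases
      case 1
      show False
        using one nt[of "p + 3" c "p + r + 2" "p + r + 3"] nt[of "p + 3" c "p + r + 4" "p + 2 * r"]
          high[of "p + r + 3"] high[of "p + r + 4"] cz 1 mb by (auto simp: conn_def)
    next
      case 2
      show False
        using one nt[of "p + r - 2" c "p + r + 2" "p + 2 * r - 2"]
        nt[of "p + r - 2" c "p + 2 * r - 1" "p + 2 * r"]
          high[of "p + 2 * r - 2"] high[of "p + 2 * r - 1"] cz 2 mb by (auto simp: conn_def)
    next
      case 3
      have "conn (p + r + 3 - z)" "conn (p + 2 * r - 1 - (p + r + 3))" "conn (z + m - (p + 2 * r - 1))"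
        using z 3 mb unfolding conn_def by (smt (verit))+
      then show False
        using nt[of z c "p + r + 3" "p + 2 * r - 1"] high[of "p + r + 3"] high[of "p + 2 * r - 1"] cz mb
        by auto
    qed
  qed
  \<comment> \<open>\<open>x\<close> is the extreme position that may still have colour
    \<open>b\<close>; \<open>other\<close> says that the second one already has colour
    \<open>c\<close>.\<close>
  have inter: "interlocked (\<alpha>(x mod m := c)) a b c p"
    if x: "x = p + r + 2 \<or> x = p + 2 * r" and other:
      "\<And>z. z = p + r + 2 \<or> z = p + 2 * r \<Longrightarrow> z = x \<or> col \<alpha> z = c" for x
  proof -
    let ?\<beta> = "\<alpha>(x mod m := c)"
    have col: "col ?\<beta> w = (if w = x then c else col \<alpha> w)" if "p \<le> w" "w < p + m" for w
      using col_upd[OF that, of x] x mb by auto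
    have "col ?\<beta> z = c" if z: "p + r + 1 < z" "z < p + m" for z
    proof -
      have "z = p + r + 2 \<or> z = p + 2 * r \<or> p + r + 3 \<le> z \<and> z \<le> p + 2 * r - 1"
        using z mb by auto
      then show ?thesis using col[of z] high[of z] other[of z] z r5 by auto
    qed
    moreover have "col ?\<beta> z = col \<alpha> z" if "p \<le> z" "z \<le> p + r + 1" for z
      using col[of z] that x mb by auto
    ultimately show ?thesis
      unfolding interlocked_def using upd_in[OF rng ne(6)] abc pa pb low r5 by auto
  qed
  show ?thesis
  proof (cases "col \<alpha> (p + r + 2) = c")
    case True
    then have "interlocked (\<alpha>((p + 2 * r) mod m := c)) a b c p" by (intro inter) auto
    then show ?thesis by (rule interlocked_near[OF \<alpha>])
  next
    case False
    then have "interlocked (\<alpha>((p + r + 2) mod m := c)) a b c p" using one by (intro inter) auto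
    then show ?thesis by (rule interlocked_near[OF \<alpha>])
  qed
qed

text \<open>If a gap were longer than \<open>r\<close>, the vertex just after the end of the first
  window would lie in no window.\<close>

lemma arcs_contained:
  assumes \<alpha>: "\<alpha> \<in> V \<rightarrow>\<^sub>E {1..3}" and abc: "{a, b, c} = {1..3}"
    and ord: "x < y" "y < z" "z < x + m"
    and f: "fits \<alpha> a x 0" "fits \<alpha> b y 0" "fits \<alpha> c z 0"
  shows "contained \<alpha> a b c x y z"
proof -
  have gap: "y - x \<le> r"
    if abc: "{a, b, c} = {1..3}" and ord: "x < y" "y < z" "z < x + m"
      and f: "fits \<alpha> a x 0" "fits \<alpha> b y 0" "fits \<alpha> c z 0" for a b c x y z
  proof (rule ccontr)
    assume "\<not> ?thesis"
    then show False
      using col_cases[OF \<alpha> abc, of "x + r"] fitsD(1)[OF f(1), of "x + r"]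
        fitsD(1)[OF f(2), of "x + r + m"] fitsD(1)[OF f(3), of "x + r + m"] ord m_bounds r5 by auto
  qed
  have f': "fits \<alpha> a (x + m) 0" "fits \<alpha> b (y + m) 0"
    using f fits_shift[of \<alpha> a x 1 0] fits_shift[of \<alpha> b y 1 0] by auto
  have abc': "{b, c, a} = {1..3}" "{c, a, b} = {1..3}" using abc by (auto simp: insert_commute)
  show ?thesis
    using gap[OF abc ord f] gap[OF abc'(1) _ _ _ f(2,3) f'(1)] gap[OF abc'(2) _ _ _ f(3) f'] ord \<alpha>
    abc f
    unfolding contained_def short_gaps_def by auto
qed

text \<open>Here \<open>b\<close> contains the neighbours \<open>p - 1\<close> and
  \<open>p + 1\<close> of \<open>p\<close>, and \<open>c\<close> contains the neighbours
  \<open>p + r\<close> and \<open>p + r + 2\<close> of \<open>p + r + 1\<close>. So \<open>b\<close>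
  starts before \<open>p\<close>, \<open>c\<close> starts after \<open>p + 2\<close>, and the cyclic
  order is \<open>b\<close>, \<open>a\<close>, \<open>c\<close>.\<close>

lemma split_repairable:
  assumes \<alpha>: "\<alpha> \<in> colorings" and abc: "{a, b, c} = {1..3::nat}"
    and pa: "col \<alpha> p = a" "ends \<alpha> a p 1" and pb: "col \<alpha> (p + 1) = b" and pc:
      "col \<alpha> (p + r) = c"
    and q: "p - m < q" "q \<le> p" "col \<alpha> q = b" "ends \<alpha> b q e"
    and s: "p + r - m < s" "s \<le> p + r" "col \<alpha> s = c" "ends \<alpha> c s g"
  shows "repairable \<alpha> b a c q p s e 1 g"
proof -
  note ne = triple_eq[OF abc]
  have rng: "\<alpha> \<in> V \<rightarrow>\<^sub>E {1..3}" using \<alpha> colorings_iff by blast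
  note nt = no_triangle[OF \<alpha>]
  note mb = m_bounds r5
  have fa: "fits \<alpha> a p 1" and la: "col \<alpha> (p + r + 1) = a"
    and e: "e = 0 \<or> e = 1" and fb: "fits \<alpha> b q e" and lb:
      "e = 1 \<Longrightarrow> col \<alpha> (q + r + 1) = b"
    and g: "g = 0 \<or> g = 1" and fc: "fits \<alpha> c s g" and lc:
      "g = 1 \<Longrightarrow> col \<alpha> (s + r + 1) = c"
    using pa(2) q(4) s(4) unfolding ends_def by auto
  have bc: "col \<alpha> z = b \<or> col \<alpha> z = c" if "p + r + 1 < z" "z < p + m" for z
    using col_cases[OF rng abc, of z] fitsD(1)[OF fa, of z] that r5 by auto
  \<comment> \<open>\<open>p + 2 * r\<close> is \<open>p - 1\<close> modulo \<open>m\<close>. With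
    colour \<open>c\<close> there, all vertices from \<open>p + r + 2\<close> to
    \<open>p + 2 * r - 1\<close> would have colour \<open>b\<close> and form a triangle with
    \<open>p + 1\<close>.\<close>
  have top: "col \<alpha> (p + 2 * r) = b"
  proof (rule ccontr)
    assume "\<not> ?thesis"
    then have c: "col \<alpha> (p + 2 * r) = c" using bc[of "p + 2 * r"] mb by auto
    have b: "col \<alpha> z = b" if z: "p + r + 2 \<le> z" "z \<le> p + 2 * r - 1" for z
      using nt[of "p + r" c z "p + 2 * r"] c pc bc[of z] z mb by (auto simp: conn_def)
    have "col \<alpha> (p + 1 + m) = b" using pb by simp
    then show False
      using nt[of "p + r + 2" b "p + 2 * r - 1" "p + 1 + m"] b[of "p + r + 2"] b[of "p + 2 * r - 1"] mb
      by (auto simp: conn_def)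
  qed
  then have top': "col \<alpha> (p + 2 * r - m) = b" by simp
  have right: "col \<alpha> (p + r + 2) = c"
    using nt[of "p + 1" b "p + r + 2" "p + 2 * r"] top pb bc[of "p + r + 2"] mb by (auto simp: conn_def)
  have q0: "q < p" using q pa ne by (cases "q = p") auto
  have q1: "p - q \<le> r - 2"
  proof -
    have "q \<noteq> p + 1 - m" using fitsD(1)[OF fb, of "p + 2 * r - m"] top' e mb by auto
    moreover have "q \<noteq> p - r"
      using q(3) la col_shift(2)[of \<alpha> "p + r + 1"] ne m by auto
    ultimately show ?thesis
      using fitsD[OF fb, of "p + 1"] pb e q q0 by auto
  qed
  have q2: "2 * e \<le> p - q"
  proof (rule ccontr)
    assume "\<not> ?thesis"
    then have "e = 1" "q = p - 1" using q0 e by auto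
    then show False using lb pc ne by auto
  qed
  have s0: "s \<noteq> p + 1" "s \<noteq> p" using s(3) pb pa ne by auto
  have s1: "p + 3 \<le> s"
  proof -
    have "p + r + 2 < s + m"
    proof (rule ccontr)
      assume "\<not> ?thesis"
      then have "s \<le> p + r + 2 - m" by simp
      then show False using fitsD(1)[OF fc, of "p + r"] pc g s mb by auto
    qed
    then show ?thesis using fitsD[OF fc, of "p + r + 2"] right g s s0 by auto
  qed
  have s2: "s - p + 2 * g \<le> r"
  proof (rule ccontr)
    assume "\<not> ?thesis"
    then have g1: "g = 1" and "s = p + r \<or> s = p + r - 1" using g s by auto
    then show False
    proof (elim disjE)
      assume "s = p + r"
      then have "s + r + 1 = p + m" using m by simp
      then have "col \<alpha> p = c" using lc[OF g1] by simp
      then show False using pa ne by simp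
    next
      assume "s = p + r - 1"
      then show False using fitsD(2)[OF fc, of "p + r"] pc g1 mb by auto
    qed
  qed
  have sr: "col \<alpha> (s + r) = b"
    using fitsD[OF fc, of "s + r"] g bc[of "s + r"] s s1 mb by auto
  have d: "q + m \<le> s + r"
  proof (rule ccontr)
    assume "\<not> ?thesis"
    then show False using fitsD(1)[OF fb, of "s + r"] sr e s1 q0 r5 by auto
  qed
  have d1: "q + m - s + 2 * e \<le> r"
  proof (rule ccontr)
    assume "\<not> ?thesis"
    then have e1: "e = 1" and "q + m = s + r - 1 \<or> q + m = s + r" using d e by auto
    then show False
    proof (elim disjE)
      assume "q + m = s + r - 1"
      then have "q + 1 = s + r - m" by simp
      then have "col \<alpha> (q + 1) = b" using sr by simp
      then show False using fitsD(2)[OF fb, of "q + 1"] e1 mb by auto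
    next
      assume "q + m = s + r"
      then have "s = q + r + 1" using m by simp
      then show False using lb[OF e1] s(3) ne by simp
    qed
  qed
  have "gap_ok e 1 (p - q)" "gap_ok 1 g (s - p)" "gap_ok g e (q + m - s)"
    using q1 q2 s1 s2 d1 s q0 g mb unfolding gap_ok_def by auto
  moreover have "{b, a, c} = {1..3}" using abc by (simp add: insert_commute)
  ultimately show ?thesis unfolding repairable_def using rng pa q s by blast
qed

text \<open>If no interlocked colouring is within one step, then no class is a triple and the two
  holes of a gapped class have different colours. A gapped class then leads to
  \<open>split_repairable\<close>; if there is none, the starts of the three arcs give the cyclic
  order.\<close>

lemma classification:
  assumes \<alpha>: "\<alpha> \<in> colorings"
  obtains (repairable) a b c x y z e f g where "repairable \<alpha> a b c x y z e f g"
  | (interlocked) \<beta> a b c p where "close \<alpha> \<beta> 1" "interlocked \<beta> a b c p"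
proof -
  have rng: "\<alpha> \<in> V \<rightarrow>\<^sub>E {1..3}" using \<alpha> colorings_iff by blast
  have third: "\<exists>c. {a, b, c} = {1..3::nat}"
    if "a \<in> {1..3}" "b \<in> {1..3}" "a \<noteq> b" for a b :: nat
  proof -
    have eq: "{1..3} = {1, 2, 3::nat}" by auto
    have "6 - a - b \<in> {1..3} \<and> {a, b, 6 - a - b} = {1..3}" using that unfolding eq by auto
    then show ?thesis by blast
  qed
  show thesis
  proof (cases "\<exists>\<beta> a b c p. close \<alpha> \<beta> 1 \<and> interlocked \<beta> a b c p")
    case True
    then show thesis using that(2) by blast
  next
    case False
    have shape: "\<exists>s e. t < s \<and> s \<le> t + m \<and> col \<alpha> s = i
      \<and> ends \<alpha> i s e" if i: "i \<in> {1..3}" for i t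
    proof -
      obtain w where "col \<alpha> w = i" using all_colors_used[OF \<alpha> i] by blast
      with \<alpha> show ?thesis
      proof (cases rule: class_type_window[where t = t])
        case (ends s e)
        then show ?thesis by blast
      next
        case (triple s)
        have "col \<alpha> (s + 1) \<noteq> i" using triple(3)[of "s + 1"] m_bounds r5 by auto
        then obtain c where "{i, col \<alpha> (s + 1), c} = {1..3}"
          using third[OF i coloring_range[OF rng]] by metis
        from triple_near_interlocked[OF \<alpha> this triple(4,5,6) refl triple(3)]
        show ?thesis using False by blast
      qed
    qed
    show thesis
    proof (cases "\<exists>i\<in>{1..3}. \<exists>p. col \<alpha> p = i \<and> ends \<alpha> i p 1")
      case True
      then obtain a p where a: "a \<in> {1..3}" "col \<alpha> p = a" "ends \<alpha> a p 1" by blast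
      have fa: "fits \<alpha> a p 1" and la: "col \<alpha> (p + r + 1) = a" using a(3) unfolding ends_def
        by auto
      have "col \<alpha> (p + 1) \<noteq> a" using fitsD(2)[OF fa, of "p + 1"] m_bounds r5 by auto
      then obtain c where abc: "{a, col \<alpha> (p + 1), c} = {1..3}"
        using third[OF a(1) coloring_range[OF rng]] by metis
      have "col \<alpha> (p + r) \<noteq> col \<alpha> (p + 1)"
        using gapped_near_interlocked[OF \<alpha> abc a(2) la fa refl] False by blast
      moreover have "col \<alpha> (p + r) \<noteq> a" using fitsD(3)[OF fa, of "p + r"] m_bounds r5 by auto
      ultimately have pc: "col \<alpha> (p + r) = c" using col_cases[OF rng abc, of "p + r"] by auto
      note ne = triple_eq[OF abc]
      \<comment> \<open>The turns are chosen so that \<open>q\<close> is the last copy of the start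
        of \<open>b\<close> up to \<open>p\<close>, and \<open>s\<close> that of \<open>c\<close> up
        to \<open>p + r\<close>.\<close>
      obtain q e where q: "p - m < q" "q \<le> p - m + m" "col \<alpha> q = col \<alpha> (p + 1)"
        "ends \<alpha> (col \<alpha> (p + 1)) q e"
        using shape[OF ne(5), of "p - m"] by blast
      obtain s g where s: "p + r - m < s" "s \<le> p + r - m + m" "col \<alpha> s = c" "ends \<alpha> c s g"
        using shape[OF ne(6), of "p + r - m"] by blast
      have "repairable \<alpha> (col \<alpha> (p + 1)) a c q p s e 1 g"
        by (rule split_repairable[OF \<alpha> abc a(2,3) refl pc q(1) _ q(3,4) s(1) _ s(3,4)]) (use q(2)
        s(2) in auto)
      then show thesis by (rule that(1))
    next
      case no: False
      have arc: "\<exists>s. t < s \<and> s \<le> t + m \<and> col \<alpha> s = i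
        \<and> fits \<alpha> i s 0" if i: "i \<in> {1..3}" for i t
        using shape[OF i, of t] no i unfolding ends_def by blast
      obtain x where x: "col \<alpha> x = 1" "fits \<alpha> 1 x 0" using arc[of 1] by auto
      obtain y where y: "x - 1 < y" "y \<le> x - 1 + m" "col \<alpha> y = 2" "fits \<alpha> 2 y 0"
        using arc[of 2 "x - 1"] by auto
      obtain z where z: "x - 1 < z" "z \<le> x - 1 + m" "col \<alpha> z = 3" "fits \<alpha> 3 z 0"
        using arc[of 3 "x - 1"] by auto
      have "y \<noteq> x" "z \<noteq> x" "y \<noteq> z" using x(1) y(3) z(3) by auto
      then have ord: "x < y" "x < z" "y < x + m" "z < x + m" "y \<noteq> z" using y(1,2) z(1,2) by auto
      have p: "{1, 2, 3} = {1..3::nat}" "{1, 3, 2} = {1..3::nat}" by auto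
      show thesis
      proof (cases "y < z")
        case True
        from arcs_contained[OF rng p(1) ord(1) True ord(4) x(2) y(4) z(4)]
        show thesis using that(1) unfolding repairable_contained[symmetric] by blast
      next
        case False
        then have "z < y" using ord by simp
        from arcs_contained[OF rng p(2) ord(2) this ord(3) x(2) z(4) y(4)]
        show thesis using that(1) unfolding repairable_contained[symmetric] by blast
      qed
    qed
  qed
qed

text \<open>Beyond \<open>3 * r + m div 3\<close> there are at most four steps: three repairs of the
  source and one for a reversal, or two steps at each exceptional end. The order reached from an
  exceptional colouring is chosen to match the other side.\<close>

lemma close_bound:
  assumes \<alpha>: "\<alpha> \<in> colorings" and \<beta>: "\<beta> \<in> colorings"
  shows "close \<alpha> \<beta> (3 * r + 4 + m div 3)"
proof -
  have mixed: "close \<alpha> \<beta> (3 * r + 4 + m div 3)"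
    if \<gamma>: "close \<alpha> \<gamma> 1" "interlocked \<gamma> a b c p" and \<beta>:
      "repairable \<beta> a' b' c' x y z e f g"
    for \<alpha> \<beta> \<gamma> a b c p a' b' c' x y z e f g
  proof -
    have "{a', b', c'} = {1..3}" using \<beta> unfolding repairable_def by blast
    from interlocked_any_order[OF \<gamma>(2) this] obtain \<delta> u v w where \<delta>:
      "close \<gamma> \<delta> 1" "contained \<delta> a' b' c' u v w"
      by blast
    from within_dist_trans[OF \<gamma>(1) within_dist_trans[OF \<delta>(1)
      close_contained_repairable_oriented[OF \<delta>(2) \<beta>]]]
    show ?thesis by (rule within_dist_mono) simp
  qed
  show ?thesis
    using \<alpha>
  proof (cases rule: classification)
    case g: (repairable a b c x y z e f g)
    show ?thesis
      using \<beta>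
    proof (cases rule: classification)
      case g': (repairable a' b' c' x' y' z' e' f' g')
      obtain \<gamma> where \<gamma>: "contained \<gamma> a b c x y z" "close \<alpha> \<gamma> (e + f + g)"
        using give_last_all[OF g] .
      have "e + f + g \<le> 3" using g unfolding repairable_def ends_def by auto
      with within_dist_trans[OF \<gamma>(2) close_contained_repairable[OF \<gamma>(1) g']]
      show ?thesis by (elim within_dist_mono) simp
    next
      case (interlocked \<gamma> a' b' c' p)
      from close_sym[OF mixed[OF this g]] show ?thesis .
    qed
  next
    case i: (interlocked \<gamma> a b c p)
    show ?thesis
      using \<beta>
    proof (cases rule: classification)
      case (repairable a' b' c' x' y' z' e' f' g')
      from mixed[OF i this] show ?thesis .
    next
      case i': (interlocked \<delta> a' b' c' q)
      have "{a, b, c} = {1..3}" using i(2) unfolding interlocked_def by blast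
      from interlocked_any_order[OF i(2) this] interlocked_any_order[OF i'(2) this]
      obtain \<epsilon> u v w \<zeta> x y z where f: "close \<gamma> \<epsilon> 1"
        "contained \<epsilon> a b c u v w"
        "close \<delta> \<zeta> 1" "contained \<zeta> a b c x y z" by blast
      have "close \<epsilon> \<zeta> (3 * r + m div 3)"
        using close_contained_repairable_oriented[OF f(2)] f(4) unfolding repairable_contained[symmetric]
        by blast
      from within_dist_trans[OF within_dist_trans[OF i(1) f(1)]
          within_dist_trans[OF this close_sym[OF within_dist_trans[OF i'(1) f(3)]]]]
      show ?thesis by (rule within_dist_mono) simp
    qed
  qed
qed

end

theorem theorem4:
  fixes n :: nat
  assumes "n \<ge> 5"
  shows "Digraph_Component.connected (dicoloring_graph 3 (circulant_tournament n)) \<and>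
         graph_diameter (dicoloring_graph 3 (circulant_tournament n))
           \<le> ereal (real (3 * n + 4 + (2 * n + 1) div 3))"
proof -
  interpret circulant n "int n" "2 * int n + 1" using assms by unfold_locales auto
  let ?G = "dicoloring_graph 3 (circulant_tournament n)"
  have verts: "verts ?G = colorings" by (simp add: dicoloring_graph_def)
  have "{1, 2, 3} = {1..3::nat}" by auto
  then have "hub 1 2 3 0 \<in> colorings" by (rule hub_valid)
  then have "verts ?G \<noteq> {}" unfolding verts by blast
  moreover have "within_dist ?G u v (int (3 * n + 4 + (2 * n + 1) div 3))"
    if "u \<in> verts ?G" "v \<in> verts ?G" for u v
  proof -
    have "int (3 * n + 4 + (2 * n + 1) div 3) = 3 * int n + 4 + (2 * int n + 1) div 3"
      by (simp add: zdiv_int)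
    then show ?thesis using close_bound[of u v] that unfolding verts by simp
  qed
  ultimately show ?thesis using diameter_bound[OF wf_digraph_dicoloring_graph] by blast
qed

end
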